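(* Consider a $K$-armed Bayesian bandit environment with rewards in $[0,1]$, and run the algorithm B-MS (with the correct prior) with $K$ base learners, where base learner $i\in[K]$ pulls the fixed arm $i$ at all timesteps $t\in[T]$. Then the Bayesian regret of B-MS satisfies $$\mathrm{BayesRegret}_T\le\widetilde{\mathcal O}\bigl(\sqrt{KT}\bigr),$$ i.e. there are absolute constants $C,p>0$ (independent of the prior, $K$ and $T$) with $\mathrm{BayesRegret}_T\le C(\log(2KT))^p\sqrt{KT}$ for all $K,T\ge1$.
   Context: $K$-armed Bayesian bandit. The arms are $\mathcal A=[K]$. An environment $\nu$ assigns to each arm $a$ a reward distribution $\nu(a)$ on $[0,1]$ with mean $\mu_\nu(a)$; $\mu^\star_\nu=\max_{a}\mu_\nu(a)$. The environment is drawn once from a prior $\mathcal P$ and is then fixed for $T$ rounds. Protocol. There are $M$ base learners (here $M=K$); at each round $t\in[T]$ the meta learner selects a base learner $i_t\in[M]$, plays the action $a_t$ chosen by it (here $a_t=i_t$), and observes $r_t\sim\nu(a_t)$. Notation: $\mathcal I^i_t=\{l\in[t-1]:i_l=i\}$, $n^i_t=|\mathcal I^i_t|$, $\mathcal H_t=\{(a_s,r_s)\}_{s=1}^{t-1}$, and $\mathcal P_t(\cdot\mid\mathcal H_t)$ is the posterior of $\nu$ given $\mathcal H_t$ (for the correct prior $\mathcal P$). Algorithm B-MS. For $t\le M$ select the base learners in round-robin order ($i_t=t$). For $t>M$: sample an environment from $\mathcal P_t(\cdot\mid\mathcal H_t)$, independently of everything else given the history, with mean-reward function $\tilde\mu_t$;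 let $\tilde\mu_t^\star=\max_a\tilde\mu_t(a)$, $\phi_t(i)=n^i_t\tilde\mu^\star_t-\sum_{l\in\mathcal I^i_t}\tilde\mu_t(a_l)$, and select $i_t\in\arg\min_{i\in[M]}\phi_t(i)$. $\mathrm{BayesRegret}_T=\mathbb E\bigl[\sum_{t=1}^T(\mu^\star_\nu-\mu_\nu(a_t))\bigr]$, with expectation over $\nu\sim\mathcal P$, the rewards, and the internal randomization. *)

theory Defs
  imports "HOL-Probability.Probability"
begin

section \<open>Environments\<close>

text \<open>
  Arms are \<open>{1..K}\<close>.  An environment assigns to each arm a probability distribution on \<open>[0,1]\<close>;
  the set of environments carries the product of the Giry sigma-algebras, and a prior is a
  probability measure on it.
\<close>

type_synonym env = "nat \<Rightarrow> real measure"

definition reward_space :: "real measure" where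
  "reward_space = restrict_space borel {0..1}"

definition env_space :: "nat \<Rightarrow> env measure" where
  "env_space K = (\<Pi>\<^sub>M a\<in>{1..K}. prob_algebra reward_space)"

definition mean_reward :: "env \<Rightarrow> nat \<Rightarrow> real" where
  "mean_reward \<nu> a = (\<integral>x. x \<partial>(\<nu> a))"

definition opt_mean :: "nat \<Rightarrow> env \<Rightarrow> real" where
  "opt_mean K \<nu> = Max (mean_reward \<nu> ` {1..K})"


section \<open>Transcripts\<close>

text \<open>
  A transcript of \<open>n\<close> rounds records at each \<open>l \<in> {1..n}\<close> the triple \<open>(i\<^sub>l, a\<^sub>l, r\<^sub>l)\<close> of the
  selected base learner, the arm played and the reward.  The history \<open>\<H>\<^sub>t\<close> on which the posterior
  is conditioned keeps only the pairs \<open>(a\<^sub>l, r\<^sub>l)\<close>.  Everything that happens before round \<open>t\<close> is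
  indexed by the number \<open>n = t - 1\<close> of completed rounds.
\<close>

type_synonym transcript = "nat \<Rightarrow> nat \<times> nat \<times> real"
type_synonym history = "nat \<Rightarrow> nat \<times> real"

definition transcript_space :: "nat \<Rightarrow> nat \<Rightarrow> nat \<Rightarrow> transcript measure" where
  "transcript_space M K n =
     (\<Pi>\<^sub>M l\<in>{1..n}. count_space {1..M} \<Otimes>\<^sub>M (count_space {1..K} \<Otimes>\<^sub>M reward_space))"

definition history_space :: "nat \<Rightarrow> nat \<Rightarrow> history measure" where
  "history_space K n = (\<Pi>\<^sub>M l\<in>{1..n}. count_space {1..K} \<Otimes>\<^sub>M reward_space)"

definition learner :: "transcript \<Rightarrow> nat \<Rightarrow> nat" where
  "learner h l = fst (h l)"

definition arm :: "transcript \<Rightarrow> nat \<Rightarrow> nat" where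
  "arm h l = fst (snd (h l))"

definition history :: "nat \<Rightarrow> transcript \<Rightarrow> history" where
  "history n h = (\<lambda>l\<in>{1..n}. snd (h l))"


section \<open>The algorithm B-MS\<close>

definition rounds_of :: "nat \<Rightarrow> transcript \<Rightarrow> nat \<Rightarrow> nat set" where
  "rounds_of n h i = {l \<in> {1..n}. learner h l = i}"

definition phi :: "nat \<Rightarrow> nat \<Rightarrow> transcript \<Rightarrow> env \<Rightarrow> nat \<Rightarrow> real" where
  "phi K n h \<nu>' i =
     real (card (rounds_of n h i)) * opt_mean K \<nu>' - (\<Sum>l\<in>rounds_of n h i. mean_reward \<nu>' (arm h l))"

text \<open>
  The choice of a minimiser of \<open>phi\<close> is left open: \<open>tie t\<close> is an arbitrary, possibly randomised,
  rule that sees the transcript and the sampled environment, and is concentrated on the minimisers.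
\<close>

definition argmin_rule ::
    "nat \<Rightarrow> nat \<Rightarrow> nat \<Rightarrow> (transcript \<times> env \<Rightarrow> nat measure) \<Rightarrow> bool" where
  "argmin_rule M K n q \<longleftrightarrow>
     q \<in> transcript_space M K n \<Otimes>\<^sub>M env_space K \<rightarrow>\<^sub>M prob_algebra (count_space {1..M}) \<and>
     (\<forall>h\<in>space (transcript_space M K n). \<forall>\<nu>'\<in>space (env_space K).
        AE i in q (h, \<nu>'). is_arg_min (phi K n h \<nu>') (\<lambda>i. i \<in> {1..M}) i)"

text \<open>
  Law of \<open>i\<^sub>t\<close>, \<open>t = Suc n\<close>, given the transcript \<open>h\<close> of the first \<open>n\<close> rounds, where
  \<open>post t\<close> maps a history to a distribution over environments.
\<close>

definition bms_select ::
    "nat \<Rightarrow> (nat \<Rightarrow> history \<Rightarrow> env measure) \<Rightarrow> (nat \<Rightarrow> transcript \<times> env \<Rightarrow> nat measure)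
      \<Rightarrow> nat \<Rightarrow> transcript \<Rightarrow> nat measure" where
  "bms_select M post tie n h =
     (if Suc n \<le> M then return (count_space {1..M}) (Suc n)
      else do {
        \<nu>' \<leftarrow> post (Suc n) (history n h);
        tie (Suc n) (h, \<nu>')
      })"

text \<open>
  Joint law of the environment and the transcript after \<open>n\<close> rounds.  The measure \<open>base i t h\<close> is
  the distribution of the arm that base learner \<open>i\<close> plays when selected in round \<open>t\<close> after
  transcript \<open>h\<close>.
\<close>

primrec bms_law ::
    "nat \<Rightarrow> nat \<Rightarrow> (nat \<Rightarrow> nat \<Rightarrow> transcript \<Rightarrow> nat measure) \<Rightarrow> env measure
      \<Rightarrow> (nat \<Rightarrow> history \<Rightarrow> env measure) \<Rightarrow> (nat \<Rightarrow> transcript \<times> env \<Rightarrow> nat measure)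
      \<Rightarrow> nat \<Rightarrow> (env \<times> transcript) measure" where
  "bms_law M K base prior post tie 0 =
     distr prior (env_space K \<Otimes>\<^sub>M transcript_space M K 0) (\<lambda>\<nu>. (\<nu>, \<lambda>l. undefined))"
| "bms_law M K base prior post tie (Suc n) =
     do {
       (\<nu>, h) \<leftarrow> bms_law M K base prior post tie n;
       i \<leftarrow> bms_select M post tie n h;
       a \<leftarrow> base i (Suc n) h;
       r \<leftarrow> \<nu> a;
       return (env_space K \<Otimes>\<^sub>M transcript_space M K (Suc n)) (\<nu>, h(Suc n := (i, a, r)))
     }"

definition fixed_arm :: "nat \<Rightarrow> nat \<Rightarrow> nat \<Rightarrow> transcript \<Rightarrow> nat measure" where
  "fixed_arm K i t h = return (count_space {1..K}) i"


section \<open>Posterior and Bayesian regret\<close>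

text \<open>\<open>\<kappa>\<close> is a regular conditional distribution of \<open>X\<close> given \<open>Y\<close> under \<open>L\<close>.\<close>

definition regular_cond_distr ::
    "'w measure \<Rightarrow> 'x measure \<Rightarrow> ('w \<Rightarrow> 'x) \<Rightarrow> 'y measure \<Rightarrow> ('w \<Rightarrow> 'y) \<Rightarrow> ('y \<Rightarrow> 'x measure) \<Rightarrow> bool" where
  "regular_cond_distr L S X S' Y \<kappa> \<longleftrightarrow>
     X \<in> L \<rightarrow>\<^sub>M S \<and> Y \<in> L \<rightarrow>\<^sub>M S' \<and> \<kappa> \<in> S' \<rightarrow>\<^sub>M prob_algebra S \<and>
     (\<forall>A\<in>sets S. \<forall>B\<in>sets S'.
        emeasure L {w \<in> space L. X w \<in> A \<and> Y w \<in> B} =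
        (\<integral>\<^sup>+w. emeasure (\<kappa> (Y w)) A * indicator B (Y w) \<partial>L))"

text \<open>
  \<open>post t\<close> is a version of the posterior of the environment given \<open>\<H>\<^sub>t\<close>, for every round
  \<open>t \<in> {M<..T}\<close> in which B-MS uses it.  This is not circular: the law of \<open>\<H>\<^sub>t\<close> depends only on
  \<open>post s\<close> with \<open>s < t\<close>.
\<close>

definition is_posterior ::
    "nat \<Rightarrow> nat \<Rightarrow> nat \<Rightarrow> (nat \<Rightarrow> nat \<Rightarrow> transcript \<Rightarrow> nat measure) \<Rightarrow> env measure
      \<Rightarrow> (nat \<Rightarrow> history \<Rightarrow> env measure) \<Rightarrow> (nat \<Rightarrow> transcript \<times> env \<Rightarrow> nat measure) \<Rightarrow> bool" where
  "is_posterior M K T base prior post tie \<longleftrightarrow>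
     (\<forall>n. M \<le> n \<and> n < T \<longrightarrow>
        regular_cond_distr (bms_law M K base prior post tie n)
          (env_space K) fst (history_space K n) (\<lambda>(\<nu>, h). history n h) (post (Suc n)))"

definition bayes_regret ::
    "nat \<Rightarrow> nat \<Rightarrow> nat \<Rightarrow> (nat \<Rightarrow> nat \<Rightarrow> transcript \<Rightarrow> nat measure) \<Rightarrow> env measure
      \<Rightarrow> (nat \<Rightarrow> history \<Rightarrow> env measure) \<Rightarrow> (nat \<Rightarrow> transcript \<times> env \<Rightarrow> nat measure) \<Rightarrow> real" where
  "bayes_regret M K T base prior post tie =
     (\<integral>(\<nu>, h). (\<Sum>t=1..T. opt_mean K \<nu> - mean_reward \<nu> (arm h t))
        \<partial>bms_law M K base prior post tie T)"

end

theory Submission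
  imports Defs
begin

text \<open>
  When every base learner plays a fixed arm, \<open>phi K n h \<nu>'\<close> is the number of pulls times the gap
  under \<open>\<nu>'\<close>, so once every arm has been pulled its minimisers are the optimal arms of the sampled
  environment: B-MS is Thompson sampling with arbitrary tie-breaking.

  Deviations of the empirical means are controlled, for all arms at once, by the sum over arms
  and over the scales \<open>\<theta> = \<plusminus>1/\<surd>j\<close>, \<open>1 \<le> j \<le> T\<close>, of the exponential supermartingales
  \<open>exp (\<Sum> \<theta> (r\<^sub>l - \<mu>) - \<theta>\<^sup>2)\<close>, whose expectation stays below \<open>2KT\<close>.  With
  \<open>c = 2KT\<^sup>2\<close>, an arm pulled \<open>m\<close> times has deviation at most \<open>ln c / \<surd>m\<close> plus this potential
  divided by \<open>c\<close>.  The posterior property transfers both the optimal mean and the potential between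
  the true and the sampled environment, so in expectation each round after the first \<open>K\<close> costs at most
  \<open>2 ln c / \<surd>m + 2/T\<close>, where \<open>m\<close> counts the previous pulls of the arm played.  The terms \<open>1/\<surd>m\<close>
  telescope against the sum over arms of the square roots of the pull counts, which is at most
  \<open>\<surd>(KT)\<close>.
\<close>

section \<open>Bounded functions under probability measures and composed kernels\<close>

lemma abs_prob_integral_le:
  fixes f :: "'a \<Rightarrow> real"
  assumes "prob_space M" "\<And>x. x \<in> space M \<Longrightarrow> \<bar>f x\<bar> \<le> B" "0 \<le> B"
  shows "\<bar>\<integral>x. f x \<partial>M\<bar> \<le> B"
proof (cases "integrable M f")
  case True
  interpret prob_space M by fact
  have "\<bar>\<integral>x. f x \<partial>M\<bar> \<le> (\<integral>x. \<bar>f x\<bar> \<partial>M)"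
    by (rule integral_abs_bound)
  also have "\<dots> \<le> B"
    using True assms(2) by (intro integral_le_const AE_I2) auto
  finally show ?thesis .
next
  case False
  \<comment> \<open>A non-integrable function has Bochner integral 0, which is why
    \<open>0 \<le> B\<close> is assumed and measurability is not.\<close>
  then show ?thesis using assms(3) by (simp add: not_integrable_integral_eq)
qed

lemma prob_integrable_bounded:
  fixes f :: "'a \<Rightarrow> real"
  assumes "prob_space M" "f \<in> borel_measurable M" "\<And>x. x \<in> space M \<Longrightarrow> \<bar>f x\<bar> \<le> B"
  shows "integrable M f"
proof -
  interpret prob_space M by fact
  show ?thesis using assms by (intro integrable_const_bound[where B=B] AE_I2) auto
qed

text \<open>Tower rule for bounded functions. Together with the integrability of the inner integral
  it drives every one-step computation along the law of the process.\<close>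

lemma prob_integral_bind:
  fixes f :: "'b \<Rightarrow> real"
  assumes M: "prob_space M" and N: "N \<in> M \<rightarrow>\<^sub>M prob_algebra S"
    and f: "f \<in> borel_measurable S" and bnd: "\<And>x. x \<in> space S \<Longrightarrow> \<bar>f x\<bar> \<le> B"
  shows "(\<integral>x. f x \<partial>(M \<bind> N)) = (\<integral>w. (\<integral>x. f x \<partial>N w) \<partial>M)"
    and "integrable M (\<lambda>w. \<integral>x. f x \<partial>N w)"
proof -
  interpret prob_space M by fact
  have ps: "prob_space (N w)" "space (N w) = space S" if "w \<in> space M" for w
    using measurable_space[OF N that] by (auto simp: space_prob_algebra dest: sets_eq_imp_space_eq)
  show "(\<integral>x. f x \<partial>(M \<bind> N)) = (\<integral>w. (\<integral>x. f x \<partial>N w) \<partial>M)"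
  proof (rule integral_bind[where K=S and B=B and B'=1])
    show "AE w in M. emeasure (N w) (space (N w)) \<le> ennreal 1"
      using ps(1) by (intro AE_I2) (simp add: prob_space.emeasure_space_1)
  qed (use f bnd N in \<open>auto simp: measurable_prob_algebraD\<close>)
  \<comment> \<open>The pointwise bound yields \<open>0 \<le> B\<close> only if \<open>S\<close> is
    inhabited; a point comes from the kernel at some \<open>w0\<close>, since probability spaces are
    nonempty.\<close>
  obtain w0 where "w0 \<in> space M" using not_empty by auto
  then obtain z where "z \<in> space S"
    using ps prob_space.not_empty by fastforce
  then have "0 \<le> B" using bnd by fastforce
  show "integrable M (\<lambda>w. \<integral>x. f x \<partial>N w)"
  proof (rule prob_integrable_bounded[OF M])
    show "(\<lambda>w. \<integral>x. f x \<partial>N w) \<in> borel_measurable M"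
      using measurable_prob_algebraD[OF N] integral_measurable_subprob_algebra[OF f]
      by (rule measurable_compose)
    show "\<bar>\<integral>x. f x \<partial>N w\<bar> \<le> B" if "w \<in> space M" for w
      using ps[OF that] bnd \<open>0 \<le> B\<close> by (intro abs_prob_integral_le) auto
  qed
qed

section \<open>Mean rewards and the posterior\<close>

lemma space_reward_space [simp]: "space reward_space = {0..1}"
  by (simp add: reward_space_def space_restrict_space)

lemma measurable_ident_reward_space [measurable]: "(\<lambda>x. x) \<in> reward_space \<rightarrow>\<^sub>M borel"
  unfolding reward_space_def by (intro measurable_restrict_space1) simp

lemma measurable_env_component:
  assumes "a \<in> {1..K}"
  shows "(\<lambda>\<nu>. \<nu> a) \<in> env_space K \<rightarrow>\<^sub>M prob_algebra reward_space"
  using assms unfolding env_space_def by (rule measurable_component_singleton)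

text \<open>The arm may itself depend on \<open>x\<close>, as it does when it is read off a
  transcript. It takes countably many values, so measurability for each constant arm is
  enough.\<close>

lemma measurable_env_apply [measurable (raw)]:
  assumes f: "f \<in> M \<rightarrow>\<^sub>M env_space K" and g: "g \<in> M \<rightarrow>\<^sub>M count_space {1..K}"
  shows "(\<lambda>x. f x (g x)) \<in> M \<rightarrow>\<^sub>M prob_algebra reward_space"
proof (rule measurable_compose_countable'[OF _ g])
  show "(\<lambda>x. f x a) \<in> M \<rightarrow>\<^sub>M prob_algebra reward_space" if "a \<in> {1..K}" for a
    using measurable_compose[OF f measurable_env_component[OF that]] .
qed simp

lemma env_arm_prob_space:
  assumes "\<nu> \<in> space (env_space K)" "a \<in> {1..K}"
  shows "prob_space (\<nu> a)" "sets (\<nu> a) = sets reward_space" "space (\<nu> a) = {0..1}"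
proof -
  have "\<nu> a \<in> space (prob_algebra reward_space)"
    using measurable_space[OF measurable_env_component[OF assms(2)] assms(1)] .
  then show "prob_space (\<nu> a)" "sets (\<nu> a) = sets reward_space"
    by (auto simp: space_prob_algebra)
  then show "space (\<nu> a) = {0..1}"
    by (metis sets_eq_imp_space_eq space_reward_space)
qed

lemma measurable_mean_reward [measurable (raw)]:
  assumes f: "f \<in> M \<rightarrow>\<^sub>M env_space K" and g: "g \<in> M \<rightarrow>\<^sub>M count_space {1..K}"
  shows "(\<lambda>x. mean_reward (f x) (g x)) \<in> borel_measurable M"
proof -
  have "(\<lambda>x. f x (g x)) \<in> M \<rightarrow>\<^sub>M subprob_algebra reward_space"
    using f g by (intro measurable_prob_algebraD measurable_env_apply)
  then show ?thesis
    unfolding mean_reward_def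
    by (rule measurable_compose) (rule integral_measurable_subprob_algebra, rule measurable_ident_reward_space)
qed

lemma env_arm_integrable:
  fixes f :: "real \<Rightarrow> real"
  assumes "\<nu> \<in> space (env_space K)" "a \<in> {1..K}"
    and "f \<in> borel_measurable reward_space" "\<And>x. x \<in> {0..1} \<Longrightarrow> \<bar>f x\<bar> \<le> B"
  shows "integrable (\<nu> a) f"
proof -
  interpret prob_space "\<nu> a" using env_arm_prob_space[OF assms(1,2)] by simp
  show ?thesis
    using assms env_arm_prob_space[OF assms(1,2)]
    by (intro integrable_const_bound[where B=B]) (auto intro!: AE_I2 cong: measurable_cong_sets)
qed

lemma mean_reward_bounds:
  assumes "\<nu> \<in> space (env_space K)" "a \<in> {1..K}"
  shows "0 \<le> mean_reward \<nu> a" "mean_reward \<nu> a \<le> 1"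
proof -
  note ps = env_arm_prob_space[OF assms]
  interpret prob_space "\<nu> a" by (fact ps)
  have int: "integrable (\<nu> a) (\<lambda>x. x)"
    by (rule env_arm_integrable[OF assms, where B=1]) auto
  show "0 \<le> mean_reward \<nu> a"
    unfolding mean_reward_def using ps by (intro integral_nonneg_AE AE_I2) simp
  show "mean_reward \<nu> a \<le> 1"
    unfolding mean_reward_def using ps int by (intro integral_le_const AE_I2) simp_all
qed

lemma measurable_opt_mean [measurable]: "opt_mean K \<in> borel_measurable (env_space K)"
proof -
  have "(\<lambda>\<nu>. Max ((\<lambda>a. mean_reward \<nu> a) ` {1..K})) \<in> borel_measurable (env_space K)"
    by (rule borel_measurable_Max) (auto intro!: measurable_mean_reward)
  then show ?thesis by (simp add: opt_mean_def[abs_def])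
qed

lemma opt_mean_ge: "a \<in> {1..K} \<Longrightarrow> mean_reward \<nu> a \<le> opt_mean K \<nu>"
  by (simp add: opt_mean_def)

lemma opt_mean_attained:
  assumes "1 \<le> K"
  obtains a where "a \<in> {1..K}" "mean_reward \<nu> a = opt_mean K \<nu>"
proof -
  have "opt_mean K \<nu> \<in> mean_reward \<nu> ` {1..K}"
    unfolding opt_mean_def using assms by (intro Max_in) auto
  then show ?thesis using that by auto
qed

lemma opt_mean_bounds:
  assumes "1 \<le> K" "\<nu> \<in> space (env_space K)"
  shows "0 \<le> opt_mean K \<nu>" "opt_mean K \<nu> \<le> 1"
  using opt_mean_attained[OF assms(1), of \<nu>] mean_reward_bounds[OF assms(2)] by metis+

section \<open>Transcripts, histories and integration against a posterior\<close>

lemma measurable_learner [measurable]: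
  assumes "l \<in> {1..n}"
  shows "(\<lambda>h. learner h l) \<in> transcript_space M K n \<rightarrow>\<^sub>M count_space {1..M}"
  unfolding learner_def transcript_space_def using assms by measurable

lemma measurable_arm [measurable]:
  assumes "l \<in> {1..n}"
  shows "(\<lambda>h. arm h l) \<in> transcript_space M K n \<rightarrow>\<^sub>M count_space {1..K}"
  unfolding arm_def transcript_space_def using assms by measurable

lemma measurable_history [measurable]:
  "history n \<in> transcript_space M K n \<rightarrow>\<^sub>M history_space K n"
  unfolding history_def transcript_space_def history_space_def by measurable

lemma history_Suc_upd: "history (Suc n) (h(Suc n := x)) = (history n h)(Suc n := snd x)"
  by (auto simp: history_def fun_eq_iff)

text \<open>This is the identity behind posterior sampling: given \<open>Y\<close>, a draw from
  \<open>\<kappa> (Y w)\<close> may replace \<open>X\<close> under the integral. The definition of a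
  regular conditional distribution gives it for rectangles; these form an intersection-stable
  generator of the product, so the two joint laws coincide and bounded \<open>g\<close> can be
  integrated against either.\<close>

lemma regular_cond_distr_integral:
  fixes g :: "'x \<Rightarrow> 'y \<Rightarrow> real"
  assumes L: "prob_space L" and rcd: "regular_cond_distr L S X S' Y \<kappa>"
    and g [measurable]: "(\<lambda>(x, y). g x y) \<in> borel_measurable (S \<Otimes>\<^sub>M S')"
    and bnd: "\<And>x y. x \<in> space S \<Longrightarrow> y \<in> space S' \<Longrightarrow> \<bar>g x y\<bar> \<le> B"
  shows "integrable L (\<lambda>w. \<integral>x. g x (Y w) \<partial>\<kappa> (Y w))" (is ?int)
    and "(\<integral>w. g (X w) (Y w) \<partial>L) = (\<integral>w. (\<integral>x. g x (Y w) \<partial>\<kappa> (Y w)) \<partial>L)" (is ?eq)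
proof -
  interpret prob_space L by fact
  have X [measurable]: "X \<in> L \<rightarrow>\<^sub>M S" and Y [measurable]: "Y \<in> L \<rightarrow>\<^sub>M S'"
    and k [measurable]: "\<kappa> \<in> S' \<rightarrow>\<^sub>M prob_algebra S"
    and eq: "\<And>A B. A \<in> sets S \<Longrightarrow> B \<in> sets S' \<Longrightarrow>
        emeasure L {w \<in> space L. X w \<in> A \<and> Y w \<in> B} =
        (\<integral>\<^sup>+w. emeasure (\<kappa> (Y w)) A * indicator B (Y w) \<partial>L)"
    using rcd by (auto simp: regular_cond_distr_def)
  have kY: "prob_space (\<kappa> (Y w))" "sets (\<kappa> (Y w)) = sets S" if "w \<in> space L" for w
    using measurable_space[OF k measurable_space[OF Y that]] by (auto simp: space_prob_algebra)
  \<comment> \<open>The law of the pair in which \<open>X\<close> is resampled from the kernel while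
    \<open>Y w\<close> is kept.\<close>
  define N where "N = (\<lambda>w. distr (\<kappa> (Y w)) (S \<Otimes>\<^sub>M S') (\<lambda>x. (x, Y w)))"
  have N: "N \<in> L \<rightarrow>\<^sub>M prob_algebra (S \<Otimes>\<^sub>M S')"
    unfolding N_def by measurable
  have ps: "prob_space (N w)" if "w \<in> space L" for w
    using measurable_space[OF N that] by (simp add: space_prob_algebra)
  have "distr L (S \<Otimes>\<^sub>M S') (\<lambda>w. (X w, Y w)) = L \<bind> N"
  proof (rule measure_eqI_generator_eq[OF Int_stable_pair_measure_generator pair_measure_closed])
    show "sets (distr L (S \<Otimes>\<^sub>M S') (\<lambda>w. (X w, Y w)))
        = sigma_sets (space S \<times> space S') {a \<times> b |a b. a \<in> sets S \<and> b \<in> sets S'}"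
      by (simp add: sets_pair_measure)
    show "sets (L \<bind> N) = sigma_sets (space S \<times> space S') {a \<times> b |a b. a \<in> sets S \<and> b \<in> sets S'}"
      using sets_bind_measurable[OF measurable_prob_algebraD[OF N] not_empty]
      by (simp add: sets_pair_measure)
    show "range (\<lambda>_::nat. space S \<times> space S') \<subseteq> {a \<times> b |a b. a \<in> sets S \<and> b \<in> sets S'}"
      by auto
    show "emeasure (distr L (S \<Otimes>\<^sub>M S') (\<lambda>w. (X w, Y w))) (space S \<times> space S') \<noteq> \<infinity>" for i :: nat
      by (simp add: emeasure_distr emeasure_eq_measure)
    fix C assume "C \<in> {a \<times> b |a b. a \<in> sets S \<and> b \<in> sets S'}"
    then obtain A B where C: "C = A \<times> B" and [measurable]: "A \<in> sets S" "B \<in> sets S'" by auto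
    have "emeasure (distr L (S \<Otimes>\<^sub>M S') (\<lambda>w. (X w, Y w))) C
        = emeasure L {w \<in> space L. X w \<in> A \<and> Y w \<in> B}"
      unfolding C by (subst emeasure_distr) (auto intro!: arg_cong[where f="emeasure L"])
    also have "\<dots> = (\<integral>\<^sup>+w. emeasure (N w) C \<partial>L)"
      unfolding eq[OF \<open>A \<in> sets S\<close> \<open>B \<in> sets S'\<close>]
    proof (rule nn_integral_cong)
      fix w assume w: "w \<in> space L"
      have [measurable]: "(\<lambda>x. (x, Y w)) \<in> \<kappa> (Y w) \<rightarrow>\<^sub>M S \<Otimes>\<^sub>M S'"
        using measurable_space[OF Y w] kY[OF w] by (simp cong: measurable_cong_sets)
      have "emeasure (N w) C = emeasure (\<kappa> (Y w)) ((\<lambda>x. (x, Y w)) -` (A \<times> B) \<inter> space (\<kappa> (Y w)))"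
        unfolding N_def C by (subst emeasure_distr) auto
      \<comment> \<open>The section of a rectangle at \<open>Y w\<close> is either \<open>A\<close>
        or empty, which produces the indicator of \<open>B\<close> in the defining identity.\<close>
      also have "(\<lambda>x. (x, Y w)) -` (A \<times> B) \<inter> space (\<kappa> (Y w)) = (if Y w \<in> B then A else {})"
        using sets.sets_into_space[OF \<open>A \<in> sets S\<close>] sets_eq_imp_space_eq[OF kY(2)[OF w]] by auto
      finally show "emeasure (\<kappa> (Y w)) A * indicator B (Y w) = emeasure (N w) C" by auto
    qed
    also have "\<dots> = emeasure (L \<bind> N) C"
      unfolding C
      by (rule emeasure_bind[symmetric, OF not_empty measurable_prob_algebraD[OF N]]) simp
    finally show "emeasure (distr L (S \<Otimes>\<^sub>M S') (\<lambda>w. (X w, Y w))) C = emeasure (L \<bind> N) C" .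
  qed auto
  then have "(\<integral>w. g (X w) (Y w) \<partial>L) = (\<integral>z. (\<lambda>(x, y). g x y) z \<partial>(L \<bind> N))"
    by (subst \<open>_ = L \<bind> N\<close>[symmetric], subst integral_distr) (auto simp: case_prod_beta')
  moreover have "(\<integral>z. (\<lambda>(x, y). g x y) z \<partial>N w) = (\<integral>x. g x (Y w) \<partial>\<kappa> (Y w))" if w: "w \<in> space L" for w
  proof -
    have [measurable]: "(\<lambda>x. (x, Y w)) \<in> \<kappa> (Y w) \<rightarrow>\<^sub>M S \<Otimes>\<^sub>M S'"
      using measurable_space[OF Y w] kY[OF w] by (simp cong: measurable_cong_sets)
    show ?thesis
      unfolding N_def by (subst integral_distr) auto
  qed
  moreover have "\<bar>case z of (x, y) \<Rightarrow> g x y\<bar> \<le> B" if "z \<in> space (S \<Otimes>\<^sub>M S')" for z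
    using that bnd by (auto simp: space_pair_measure)
  note prob_integral_bind[OF L N g this]
  ultimately show ?int ?eq
    by (simp_all cong: Bochner_Integration.integrable_cong Bochner_Integration.integral_cong)
qed

section \<open>An exponential supermartingale over all arms and scales\<close>

text \<open>For negative \<open>x\<close> put \<open>y = - x\<close>: since (1 + y)(1 - y + y^2) = 1
  + y^3, the bound follows from \<open>1 + y \<le> exp y\<close> after inverting.\<close>

lemma exp_le_quadratic:
  fixes x :: real
  assumes "\<bar>x\<bar> \<le> 1"
  shows "exp x \<le> 1 + x + x\<^sup>2"
proof (cases "0 \<le> x")
  case True
  then show ?thesis using assms exp_bound[of x] by simp
next
  case False
  define y where "y = - x"
  have y: "0 < y" "y \<le> 1" using False assms by (auto simp: y_def)
  have "1 \<le> (1 + y) * (1 - y + y\<^sup>2)"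
    using y by (simp add: algebra_simps power2_eq_square)
  also have "\<dots> \<le> exp y * (1 - y + y\<^sup>2)"
    using y exp_ge_add_one_self[of y] by (intro mult_right_mono) (auto simp: power2_eq_square)
  finally have "1 \<le> exp y * (1 - y + y\<^sup>2)" .
  then show ?thesis
    by (simp add: y_def exp_minus field_simps)
qed

text \<open>The quadratic bound applies because rewards and means lie in the unit interval. The
  linear term integrates to zero, leaving
  \<open>1 + \<theta>\<^sup>2 \<le> exp (\<theta>\<^sup>2)\<close>, so subtracting
  \<open>\<theta>\<^sup>2\<close> in the exponent is a sufficient compensator.\<close>

lemma centered_reward_mgf:
  assumes \<nu>: "\<nu> \<in> space (env_space K)" and a: "a \<in> {1..K}" and \<theta>: "\<bar>\<theta>\<bar> \<le> 1"
  shows "(\<integral>r. exp (\<theta> * (r - mean_reward \<nu> a) - \<theta>\<^sup>2) \<partial>\<nu> a) \<le> 1"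
proof -
  note ps = env_arm_prob_space[OF \<nu> a]
  interpret prob_space "\<nu> a" by (fact ps)
  define \<mu> where "\<mu> = mean_reward \<nu> a"
  have \<mu>: "0 \<le> \<mu>" "\<mu> \<le> 1" using mean_reward_bounds[OF \<nu> a] by (auto simp: \<mu>_def)
  have int: "integrable (\<nu> a) (\<lambda>r. r)"
    by (rule env_arm_integrable[OF \<nu> a, where B=1]) auto
  have bnd: "\<bar>\<theta> * (r - \<mu>)\<bar> \<le> 1" "(\<theta> * (r - \<mu>))\<^sup>2 \<le> \<theta>\<^sup>2" if "r \<in> {0..1}" for r
  proof -
    have r: "\<bar>r - \<mu>\<bar> \<le> 1" using that \<mu> by auto
    show "\<bar>\<theta> * (r - \<mu>)\<bar> \<le> 1"
      using r \<theta> by (simp add: abs_mult mult_le_one)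
    have "(r - \<mu>)\<^sup>2 \<le> 1" using r by (simp add: abs_square_le_1)
    then show "(\<theta> * (r - \<mu>))\<^sup>2 \<le> \<theta>\<^sup>2"
      by (simp add: power_mult_distrib mult_left_le)
  qed
  have int2: "integrable (\<nu> a) (\<lambda>r. 1 + \<theta>\<^sup>2 + \<theta> * (r - \<mu>))"
    using int by simp
  have int1: "integrable (\<nu> a) (\<lambda>r. exp (\<theta> * (r - \<mu>)))"
  proof (rule env_arm_integrable[OF \<nu> a, where B="exp 1"])
    show "\<bar>exp (\<theta> * (r - \<mu>))\<bar> \<le> exp 1" if "r \<in> {0..1}" for r
      using bnd(1)[OF that] by simp
  qed simp
  have "(\<integral>r. exp (\<theta> * (r - \<mu>)) \<partial>\<nu> a) \<le> (\<integral>r. 1 + \<theta>\<^sup>2 + \<theta> * (r - \<mu>) \<partial>\<nu> a)"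
  proof (rule integral_mono[OF int1 int2])
    fix r assume "r \<in> space (\<nu> a)"
    then have r: "r \<in> {0..1}" using ps by simp
    show "exp (\<theta> * (r - \<mu>)) \<le> 1 + \<theta>\<^sup>2 + \<theta> * (r - \<mu>)"
      using exp_le_quadratic[OF bnd(1)[OF r]] bnd(2)[OF r] by simp
  qed
  also have "\<dots> = 1 + \<theta>\<^sup>2"
    using int by (simp add: prob_space \<mu>_def mean_reward_def)
  also have "\<dots> \<le> exp (\<theta>\<^sup>2)" by simp
  finally have "(\<integral>r. exp (\<theta> * (r - \<mu>)) \<partial>\<nu> a) * exp (- \<theta>\<^sup>2) \<le> exp (\<theta>\<^sup>2) * exp (- \<theta>\<^sup>2)"
    by (intro mult_right_mono) simp_all
  moreover have "(\<integral>r. exp (\<theta> * (r - \<mu>) - \<theta>\<^sup>2) \<partial>\<nu> a) = (\<integral>r. exp (\<theta> * (r - \<mu>)) \<partial>\<nu> a) * exp (- \<theta>\<^sup>2)"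
    by (simp add: diff_conv_add_uminus exp_add del: add_uminus_conv_diff)
  ultimately show ?thesis by (simp add: \<mu>_def flip: exp_add)
qed

definition pulls :: "nat \<Rightarrow> history \<Rightarrow> nat \<Rightarrow> nat" where
  "pulls n \<eta> a = card {l \<in> {1..n}. fst (\<eta> l) = a}"

text \<open>Logarithm of an exponential supermartingale for one arm and one scale; rounds that play
  other arms leave it unchanged, so its clock is the pull count of \<open>a\<close>.\<close>

definition log_weight :: "nat \<Rightarrow> env \<Rightarrow> history \<Rightarrow> nat \<Rightarrow> real \<Rightarrow> real" where
  "log_weight n \<nu> \<eta> a \<theta> =
     (\<Sum>l\<in>{1..n}. if fst (\<eta> l) = a then \<theta> * (snd (\<eta> l) - mean_reward \<nu> a) - \<theta>\<^sup>2 else 0)"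

text \<open>The sum dominates each of its terms and so takes the place of a union bound, while
  remaining a supermartingale.\<close>

definition exp_pot :: "nat \<Rightarrow> real set \<Rightarrow> nat \<Rightarrow> env \<Rightarrow> history \<Rightarrow> real" where
  "exp_pot K \<Theta> n \<nu> \<eta> = (\<Sum>a\<in>{1..K}. \<Sum>\<theta>\<in>\<Theta>. exp (log_weight n \<nu> \<eta> a \<theta>))"

definition sqrt_pulls :: "nat \<Rightarrow> nat \<Rightarrow> history \<Rightarrow> real" where
  "sqrt_pulls K n \<eta> = (\<Sum>a\<in>{1..K}. sqrt (real (pulls n \<eta> a)))"

lemma pulls_Suc:
  "pulls (Suc n) (\<eta>(Suc n := (i, r))) a = pulls n \<eta> a + (if a = i then 1 else 0)"
proof -
  have eq: "{l \<in> {1..Suc n}. fst ((\<eta>(Suc n := (i, r))) l) = a}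
      = {l \<in> {1..n}. fst (\<eta> l) = a} \<union> (if a = i then {Suc n} else {})"
    by (auto simp: le_Suc_eq)
  show ?thesis
    unfolding pulls_def eq by (subst card_Un_disjoint) auto
qed

lemma log_weight_Suc:
  "log_weight (Suc n) \<nu> (\<eta>(Suc n := (i, r))) a \<theta> =
     log_weight n \<nu> \<eta> a \<theta> + (if a = i then \<theta> * (r - mean_reward \<nu> i) - \<theta>\<^sup>2 else 0)"
proof -
  have "(\<Sum>l\<in>{1..n}. if fst ((\<eta>(Suc n := (i, r))) l) = a
          then \<theta> * (snd ((\<eta>(Suc n := (i, r))) l) - mean_reward \<nu> a) - \<theta>\<^sup>2 else 0) = log_weight n \<nu> \<eta> a \<theta>"
    unfolding log_weight_def by (rule sum.cong) auto
  then show ?thesis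
    unfolding log_weight_def[of "Suc n"] by auto
qed

lemma sqrt_pulls_Suc:
  assumes "i \<in> {1..K}"
  shows "sqrt_pulls K (Suc n) (\<eta>(Suc n := (i, r))) =
     sqrt_pulls K n \<eta> + (sqrt (real (pulls n \<eta> i) + 1) - sqrt (real (pulls n \<eta> i)))"
proof -
  have "sqrt_pulls K (Suc n) (\<eta>(Suc n := (i, r))) =
    (\<Sum>a\<in>{1..K}. sqrt (real (pulls n \<eta> a)) +
      (if a = i then sqrt (real (pulls n \<eta> i) + 1) - sqrt (real (pulls n \<eta> i)) else 0))"
    unfolding sqrt_pulls_def by (rule sum.cong) (auto simp: pulls_Suc add.commute)
  then show ?thesis using assms by (simp add: sum.distrib sqrt_pulls_def)
qed

text \<open>Cauchy-Schwarz over the arms. The pull counts sum to at most \<open>n\<close>; equality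
  may fail because \<open>\<eta>\<close> is arbitrary and can name arms outside
  \<open>{1..K}\<close>.\<close>

lemma sqrt_pulls_bounds: "0 \<le> sqrt_pulls K n \<eta>" "sqrt_pulls K n \<eta> \<le> sqrt (real K * real n)"
proof -
  show "0 \<le> sqrt_pulls K n \<eta>" by (simp add: sqrt_pulls_def sum_nonneg)
  have "(\<Sum>a\<in>{1..K}. pulls n \<eta> a) = card (\<Union>a\<in>{1..K}. {l \<in> {1..n}. fst (\<eta> l) = a})"
    unfolding pulls_def by (rule card_UN_disjoint[symmetric]) auto
  also have "\<dots> \<le> card {1..n}" by (rule card_mono) auto
  finally have le: "(\<Sum>a\<in>{1..K}. pulls n \<eta> a) \<le> n" by simp
  have "(sqrt_pulls K n \<eta>)\<^sup>2 \<le> real (card {1..K}) * (\<Sum>a\<in>{1..K}. (sqrt (real (pulls n \<eta> a)))\<^sup>2)"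
    unfolding sqrt_pulls_def
    using sum_squared_le_sum_of_squares[of "\<lambda>a. sqrt (real (pulls n \<eta> a))" "{1..K}"]
    by (simp add: mult.commute)
  also have "\<dots> = real K * real (\<Sum>a\<in>{1..K}. pulls n \<eta> a)" by simp
  also have "\<dots> \<le> real K * real n" using le by (intro mult_left_mono) (simp_all only: of_nat_le_iff of_nat_0_le_iff)
  finally show "sqrt_pulls K n \<eta> \<le> sqrt (real K * real n)" by (rule real_le_rsqrt)
qed

text \<open>The difference of roots is the reciprocal of \<open>sqrt (x + 1) + sqrt x\<close>, and
  this sum is at most \<open>4 * sqrt x\<close> once \<open>1 \<le> x\<close>. It turns confidence
  widths into increments of \<open>sqrt_pulls\<close>.\<close>

lemma inverse_sqrt_le_diff:
  assumes "1 \<le> (x::real)"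
  shows "1 / sqrt x \<le> 4 * (sqrt (x + 1) - sqrt x)"
proof -
  have "sqrt (x + 1) \<le> sqrt (4 * x)" using assms by simp
  then have le: "sqrt (x + 1) \<le> 2 * sqrt x" by (simp add: real_sqrt_mult)
  have pos: "0 < sqrt x" using assms by simp
  have ge: "0 \<le> sqrt (x + 1) - sqrt x" using assms by simp
  have "1 = (sqrt (x + 1) - sqrt x) * (sqrt (x + 1) + sqrt x)"
    using assms by (simp add: algebra_simps)
  also have "\<dots> \<le> (sqrt (x + 1) - sqrt x) * (4 * sqrt x)"
    using ge le pos by (intro mult_left_mono) linarith+
  finally show ?thesis using pos by (simp add: field_simps)
qed

lemma measurable_history_component [measurable (raw)]:
  assumes f: "f \<in> M \<rightarrow>\<^sub>M history_space K n" and l: "l \<in> {1..n}"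
  shows "(\<lambda>x. fst (f x l)) \<in> M \<rightarrow>\<^sub>M count_space {1..K}" "(\<lambda>x. snd (f x l)) \<in> M \<rightarrow>\<^sub>M reward_space"
proof -
  have [measurable]: "(\<lambda>x. f x l) \<in> M \<rightarrow>\<^sub>M count_space {1..K} \<Otimes>\<^sub>M reward_space"
    using measurable_compose[OF f[unfolded history_space_def] measurable_component_singleton[OF l]] .
  show "(\<lambda>x. fst (f x l)) \<in> M \<rightarrow>\<^sub>M count_space {1..K}" "(\<lambda>x. snd (f x l)) \<in> M \<rightarrow>\<^sub>M reward_space"
    by measurable
qed

lemma history_component_bounds:
  assumes "\<eta> \<in> space (history_space K n)" "l \<in> {1..n}"
  shows "fst (\<eta> l) \<in> {1..K}" "snd (\<eta> l) \<in> {0..1}"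
  using assms by (auto simp: history_space_def space_PiM space_pair_measure PiE_def Pi_def mem_Times_iff)

lemma measurable_log_weight:
  assumes "a \<in> {1..K}"
  shows "(\<lambda>(\<nu>, \<eta>). log_weight n \<nu> \<eta> a \<theta>) \<in> borel_measurable (env_space K \<Otimes>\<^sub>M history_space K n)"
proof -
  have 1: "(\<lambda>z. fst (snd z l)) \<in> env_space K \<Otimes>\<^sub>M history_space K n \<rightarrow>\<^sub>M count_space {1..K}"
    if "l \<in> {1..n}" for l
    by (rule measurable_history_component[OF measurable_snd that])
  have [measurable]: "Measurable.pred (env_space K \<Otimes>\<^sub>M history_space K n) (\<lambda>z. fst (snd z l) = a)"
    if "l \<in> {1..n}" for l
    using measurable_compose[OF 1[OF that], of "\<lambda>x. x = a" "count_space UNIV"] by simp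
  have [measurable]: "(\<lambda>z. snd (snd z l)) \<in> borel_measurable (env_space K \<Otimes>\<^sub>M history_space K n)"
    if "l \<in> {1..n}" for l
    using measurable_compose[OF measurable_history_component(2)[OF measurable_snd that] measurable_ident_reward_space] .
  have [measurable]: "(\<lambda>z. mean_reward (fst z) a) \<in> borel_measurable (env_space K \<Otimes>\<^sub>M history_space K n)"
    using assms by (intro measurable_mean_reward) auto
  show ?thesis
    unfolding log_weight_def case_prod_beta' by measurable
qed

lemma measurable_exp_pot [measurable]:
  "(\<lambda>(\<nu>, \<eta>). exp_pot K \<Theta> n \<nu> \<eta>) \<in> borel_measurable (env_space K \<Otimes>\<^sub>M history_space K n)"
  unfolding exp_pot_def case_prod_beta'
  by (intro borel_measurable_sum borel_measurable_exp[THEN measurable_compose[rotated]]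
      measurable_log_weight[unfolded case_prod_beta'])

lemma exp_pot_nonneg: "0 \<le> exp_pot K \<Theta> n \<nu> \<eta>"
  by (simp add: exp_pot_def sum_nonneg)

text \<open>Every summand of the exponent is at most 1. The exponential size of the bound is
  harmless: it only serves to justify integrability.\<close>

lemma exp_pot_le:
  assumes \<nu>: "\<nu> \<in> space (env_space K)" and \<eta>: "\<eta> \<in> space (history_space K n)"
    and \<Theta>: "\<Theta> \<subseteq> {-1..1}"
  shows "exp_pot K \<Theta> n \<nu> \<eta> \<le> real K * (real (card \<Theta>) * exp (real n))"
proof -
  have "log_weight n \<nu> \<eta> a \<theta> \<le> real n" if a: "a \<in> {1..K}" and \<theta>: "\<theta> \<in> \<Theta>" for a \<theta>
  proof -
    have "log_weight n \<nu> \<eta> a \<theta> \<le> (\<Sum>l\<in>{1..n}. 1)"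
      unfolding log_weight_def
    proof (rule sum_mono)
      fix l assume l: "l \<in> {1..n}"
      have "\<bar>snd (\<eta> l) - mean_reward \<nu> a\<bar> \<le> 1"
        using history_component_bounds[OF \<eta> l] mean_reward_bounds[OF \<nu> a] by auto
      moreover have "\<bar>\<theta>\<bar> \<le> 1" using \<theta> \<Theta> by (auto simp: abs_le_iff)
      ultimately have "\<bar>\<theta> * (snd (\<eta> l) - mean_reward \<nu> a)\<bar> \<le> 1"
        by (simp add: abs_mult mult_le_one)
      moreover have "0 \<le> \<theta>\<^sup>2" by simp
      ultimately show "(if fst (\<eta> l) = a then \<theta> * (snd (\<eta> l) - mean_reward \<nu> a) - \<theta>\<^sup>2 else 0) \<le> 1"
        by (simp only: abs_le_iff split: if_split) linarith
    qed
    then show ?thesis by simp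
  qed
  then have "exp_pot K \<Theta> n \<nu> \<eta> \<le> (\<Sum>a\<in>{1..K}. \<Sum>\<theta>\<in>\<Theta>. exp (real n))"
    unfolding exp_pot_def by (intro sum_mono) simp
  then show ?thesis by simp
qed

text \<open>Only the weights of the played arm change, each by a factor of mean at most 1. As
  \<open>i\<close> is arbitrary, no property of the selection rule enters.\<close>

lemma exp_pot_supermartingale:
  assumes \<nu>: "\<nu> \<in> space (env_space K)" and i: "i \<in> {1..K}" and \<Theta>: "\<Theta> \<subseteq> {-1..1}"
  shows "(\<integral>r. exp_pot K \<Theta> (Suc n) \<nu> (\<eta>(Suc n := (i, r))) \<partial>\<nu> i) \<le> exp_pot K \<Theta> n \<nu> \<eta>"
proof -
  note ps = env_arm_prob_space[OF \<nu> i]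
  interpret prob_space "\<nu> i" by (fact ps)
  let ?g = "\<lambda>a \<theta> r. exp (log_weight (Suc n) \<nu> (\<eta>(Suc n := (i, r))) a \<theta>)"
  have g: "?g a \<theta> r = exp (log_weight n \<nu> \<eta> a \<theta>) *
      (if a = i then exp (\<theta> * (r - mean_reward \<nu> i) - \<theta>\<^sup>2) else 1)" for a \<theta> r
    by (simp add: log_weight_Suc exp_add)
  have int: "integrable (\<nu> i) (?g a \<theta>)" if "\<theta> \<in> \<Theta>" for a \<theta>
    unfolding g
  proof (rule integrable_mult_right, rule env_arm_integrable[OF \<nu> i, where B="exp 1"])
    fix r :: real assume r: "r \<in> {0..1}"
    have "\<bar>r - mean_reward \<nu> i\<bar> \<le> 1" using r mean_reward_bounds[OF \<nu> i] by auto
    moreover have "\<bar>\<theta>\<bar> \<le> 1" using that \<Theta> by (auto simp: abs_le_iff)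
    ultimately have "\<bar>\<theta> * (r - mean_reward \<nu> i)\<bar> \<le> 1"
      by (simp add: abs_mult mult_le_one)
    moreover have "0 \<le> \<theta>\<^sup>2" by simp
    ultimately have "\<theta> * (r - mean_reward \<nu> i) - \<theta>\<^sup>2 \<le> 1"
      by (simp only: abs_le_iff) linarith
    then show "\<bar>if a = i then exp (\<theta> * (r - mean_reward \<nu> i) - \<theta>\<^sup>2) else 1\<bar> \<le> exp 1"
      by simp
  qed simp
  have "(\<integral>r. exp_pot K \<Theta> (Suc n) \<nu> (\<eta>(Suc n := (i, r))) \<partial>\<nu> i)
      = (\<Sum>a\<in>{1..K}. \<Sum>\<theta>\<in>\<Theta>. \<integral>r. ?g a \<theta> r \<partial>\<nu> i)"
    unfolding exp_pot_def using int by (simp add: Bochner_Integration.integral_sum)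
  also have "\<dots> \<le> (\<Sum>a\<in>{1..K}. \<Sum>\<theta>\<in>\<Theta>. exp (log_weight n \<nu> \<eta> a \<theta>))"
  proof (intro sum_mono)
    fix a \<theta> assume "\<theta> \<in> \<Theta>"
    then have "\<bar>\<theta>\<bar> \<le> 1" using \<Theta> by (auto simp: abs_le_iff)
    from centered_reward_mgf[OF \<nu> i this]
    show "(\<integral>r. ?g a \<theta> r \<partial>\<nu> i) \<le> exp (log_weight n \<nu> \<eta> a \<theta>)"
      unfolding g by (cases "a = i") (simp_all add: prob_space mult_left_le)
  qed
  finally show ?thesis unfolding exp_pot_def .
qed

text \<open>An arm with \<open>m\<close> pulls is controlled by the scale \<open>1 / \<surd>m\<close>, so no stopping-time argument is needed.\<close>
definition scales :: "nat \<Rightarrow> real set" where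
  "scales T = (\<lambda>j. 1 / sqrt (real j)) ` {1..T} \<union> (\<lambda>j. - (1 / sqrt (real j))) ` {1..T}"

lemma finite_scales [simp]: "finite (scales T)"
  by (simp add: scales_def)

lemma scales_subset: "scales T \<subseteq> {-1..1}"
  proof -
  have "0 \<le> 1 / sqrt (real j)" "1 / sqrt (real j) \<le> 1" if "j \<in> {1..T}" for j
    using that by simp_all
  then show ?thesis unfolding scales_def by (force intro: order_trans[of _ 0])
qed

lemma card_scales: "card (scales T) \<le> 2 * T"
proof -
  have "card (scales T) \<le> card ((\<lambda>j. 1 / sqrt (real j)) ` {1..T}) + card ((\<lambda>j. - (1 / sqrt (real j))) ` {1..T})"
    unfolding scales_def by (rule card_Un_le)
  also have "\<dots> \<le> T + T"
    using card_image_le[of "{1..T}" "\<lambda>j. 1 / sqrt (real j)"]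
      card_image_le[of "{1..T}" "\<lambda>j. - (1 / sqrt (real j))"] by (intro add_mono) simp_all
  finally show ?thesis by simp
qed

section \<open>Deviation of empirical means from true means\<close>

definition emp_mean :: "nat \<Rightarrow> history \<Rightarrow> nat \<Rightarrow> real" where
  "emp_mean n \<eta> a = (\<Sum>l | l \<in> {1..n} \<and> fst (\<eta> l) = a. snd (\<eta> l)) / real (pulls n \<eta> a)"

text \<open>A pathwise inequality: instead of excluding an unlikely event, it charges
  \<open>exp_pot\<close> divided by \<open>c\<close> for it. At a scale of size
  \<open>1 / sqrt m\<close> the log weight is \<open>sqrt m\<close> times the signed deviation minus
  1, and no log weight can exceed the logarithm of the potential.\<close>

lemma emp_mean_deviation:
  assumes a: "a \<in> {1..K}" and m: "pulls n \<eta> a \<in> {1..T}" and c: "0 < c"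
  shows "\<bar>emp_mean n \<eta> a - mean_reward \<nu> a\<bar>
     \<le> ln c / sqrt (real (pulls n \<eta> a)) + exp_pot K (scales T) n \<nu> \<eta> / c"
proof -
  define m where "m = real (pulls n \<eta> a)"
  define \<mu> where "\<mu> = mean_reward \<nu> a"
  define d where "d = emp_mean n \<eta> a - \<mu>"
  define \<Phi> where "\<Phi> = exp_pot K (scales T) n \<nu> \<eta>"
  have m1: "1 \<le> m" using m by (simp add: m_def)
  have \<Phi>: "0 \<le> \<Phi>" by (simp add: \<Phi>_def exp_pot_nonneg)
  have lw: "log_weight n \<nu> \<eta> a \<theta> = \<theta> * (m * d) - m * \<theta>\<^sup>2" for \<theta>
  proof -
    have "log_weight n \<nu> \<eta> a \<theta> = (\<Sum>l | l \<in> {1..n} \<and> fst (\<eta> l) = a. \<theta> * (snd (\<eta> l) - \<mu>) - \<theta>\<^sup>2)"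
      unfolding log_weight_def \<mu>_def by (subst sum.inter_filter) simp_all
    also have "\<dots> = \<theta> * ((\<Sum>l | l \<in> {1..n} \<and> fst (\<eta> l) = a. snd (\<eta> l)) - m * \<mu>) - m * \<theta>\<^sup>2"
      by (simp add: sum_subtractf sum_distrib_left[symmetric] m_def pulls_def)
    also have "(\<Sum>l | l \<in> {1..n} \<and> fst (\<eta> l) = a. snd (\<eta> l)) = m * emp_mean n \<eta> a"
      using m1 by (simp add: emp_mean_def m_def)
    finally show ?thesis by (simp add: d_def algebra_simps)
  qed
  \<comment> \<open>The sign \<open>s\<close> selects the upper or lower deviation. Both scales are
    available since \<open>m\<close> is between 1 and \<open>T\<close>.\<close>
  have key: "s * d \<le> ln c / sqrt m + \<Phi> / c" if s: "s = 1 \<or> s = - 1" for s :: real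
  proof -
    define \<theta> where "\<theta> = s / sqrt m"
    have "\<theta> \<in> scales T"
      using s m unfolding \<theta>_def scales_def m_def by auto
    have "exp (log_weight n \<nu> \<eta> a \<theta>) \<le> (\<Sum>\<theta>\<in>scales T. exp (log_weight n \<nu> \<eta> a \<theta>))"
      by (rule member_le_sum[OF \<open>\<theta> \<in> scales T\<close>]) auto
    also have "\<dots> \<le> \<Phi>"
      unfolding \<Phi>_def exp_pot_def
      by (rule member_le_sum[OF a, of "\<lambda>a. \<Sum>\<theta>\<in>scales T. exp (log_weight n \<nu> \<eta> a \<theta>)"]) (auto intro: sum_nonneg)
    \<comment> \<open>The tangent bound \<Phi> \<le> c exp (\<Phi>/c - 1) replaces the logarithm of
      the potential by a term linear in it, whose expectation is under control.\<close>
    also have "\<dots> = c * (1 + (\<Phi> / c - 1))" using c by simp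
    also have "\<dots> \<le> exp (ln c) * exp (\<Phi> / c - 1)"
      using c exp_ge_add_one_self[of "\<Phi> / c - 1"] by (simp add: pos_divide_le_eq mult.commute)
    finally have "log_weight n \<nu> \<eta> a \<theta> \<le> ln c + (\<Phi> / c - 1)"
      by (simp flip: exp_add)
    moreover have "log_weight n \<nu> \<eta> a \<theta> = sqrt m * (s * d) - 1"
    proof -
      have "s\<^sup>2 = 1" using s by auto
      then have "m * \<theta>\<^sup>2 = 1" using m1 by (simp add: \<theta>_def power_divide)
      moreover have "\<theta> * (m * d) = (m / sqrt m) * (s * d)" by (simp add: \<theta>_def)
      moreover have "m / sqrt m = sqrt m" using m1 by (simp add: real_div_sqrt)
      ultimately show ?thesis by (simp add: lw)
    qed
    \<comment> \<open>The compensator \<open>m * \<theta>\<^sup>2 = 1\<close> cancels against the -1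
      of the tangent bound.\<close>
    ultimately have "sqrt m * (s * d) \<le> ln c + \<Phi> / c" by simp
    then have "s * d \<le> (ln c + \<Phi> / c) / sqrt m"
      using m1 by (simp add: pos_le_divide_eq mult.commute)
    moreover have "\<Phi> / c / sqrt m \<le> \<Phi> / c / 1"
      using \<Phi> c m1 by (intro divide_left_mono) auto
    ultimately show ?thesis by (simp add: add_divide_distrib)
  qed
  have "\<bar>d\<bar> \<le> ln c / sqrt m + \<Phi> / c"
    using key[of 1] key[of "- 1"] by (simp only: abs_le_iff) auto
  then show ?thesis by (simp add: d_def m_def \<Phi>_def \<mu>_def)
qed

section \<open>The law of B-MS with fixed arms\<close>

lemma measurable_transcript_upd [measurable (raw)]:
  assumes "f \<in> N \<rightarrow>\<^sub>M transcript_space M K n" "i \<in> N \<rightarrow>\<^sub>M count_space {1..M}"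
    "a \<in> N \<rightarrow>\<^sub>M count_space {1..K}" "r \<in> N \<rightarrow>\<^sub>M reward_space"
  shows "(\<lambda>x. (f x)(Suc n := (i x, a x, r x))) \<in> N \<rightarrow>\<^sub>M transcript_space M K (Suc n)"
  using assms unfolding transcript_space_def
  by (intro measurable_fun_upd[where J="{1..n}"] measurable_Pair) auto

lemma arm_upd: "arm (h(Suc n := (i, a, r))) l = (if l = Suc n then a else arm h l)"
  by (simp add: arm_def)

lemma learner_upd: "learner (h(Suc n := (i, a, r))) l = (if l = Suc n then i else learner h l)"
  by (simp add: learner_def)

text \<open>The two almost sure features of a run with fixed arms: the learner is the arm, and the
  first \<open>K\<close> rounds are round-robin. The second makes every pull count positive once
  \<open>K \<le> n\<close>.\<close>

definition follows_learner :: "nat \<Rightarrow> nat \<Rightarrow> transcript \<Rightarrow> bool" where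
  "follows_learner K n h \<longleftrightarrow>
     (\<forall>l\<in>{1..n}. learner h l = arm h l \<and> (l \<le> K \<longrightarrow> arm h l = l))"

lemma measurable_follows_learner [measurable]:
  "Measurable.pred (transcript_space K K n) (follows_learner K n)"
proof -
  have [measurable]: "Measurable.pred (transcript_space K K n) (\<lambda>h. learner h l = arm h l)"
    and [measurable]: "Measurable.pred (transcript_space K K n) (\<lambda>h. arm h l = l)"
    if l: "l \<in> {1..n}" for l
  proof -
    have "(\<lambda>h. (learner h l, arm h l)) \<in> transcript_space K K n \<rightarrow>\<^sub>M count_space ({1..K} \<times> {1..K})"
      using measurable_Pair[OF measurable_learner[OF l, of K K] measurable_arm[OF l, of K K]]
      by (simp add: pair_measure_countable)
    from measurable_compose[OF this, of "\<lambda>(i, a). i = a" "count_space UNIV"]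
    show "Measurable.pred (transcript_space K K n) (\<lambda>h. learner h l = arm h l)" by simp
    show "Measurable.pred (transcript_space K K n) (\<lambda>h. arm h l = l)"
      using measurable_compose[OF measurable_arm[OF l, of K K], of "\<lambda>a. a = l" "count_space UNIV"] by simp
  qed
  show ?thesis
    unfolding follows_learner_def by measurable
qed

lemma follows_learner_upd:
  "follows_learner K n h \<Longrightarrow> (Suc n \<le> K \<longrightarrow> i = Suc n) \<Longrightarrow>
     follows_learner K (Suc n) (h(Suc n := (i, i, r)))"
  by (auto simp: follows_learner_def arm_upd learner_upd le_Suc_eq)

lemma follows_learner_phi:
  assumes "follows_learner K n h"
  shows "phi K n h \<nu> i = real (pulls n (history n h) i) * (opt_mean K \<nu> - mean_reward \<nu> i)"
proof -
  have eq: "rounds_of n h i = {l \<in> {1..n}. fst (history n h l) = i}"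
    using assms by (auto simp: rounds_of_def follows_learner_def history_def arm_def)
  have "(\<Sum>l\<in>rounds_of n h i. mean_reward \<nu> (arm h l)) = (\<Sum>l\<in>rounds_of n h i. mean_reward \<nu> i)"
    using assms by (intro sum.cong) (auto simp: rounds_of_def follows_learner_def)
  then show ?thesis
    by (simp add: phi_def pulls_def eq algebra_simps)
qed

text \<open>Arm \<open>i\<close> was played in round \<open>i\<close>, which is one of the first
  \<open>K\<close> rounds.\<close>

lemma follows_learner_pulls:
  assumes "follows_learner K n h" "K \<le> n" "i \<in> {1..K}"
  shows "pulls n (history n h) i \<in> {1..n}"
proof -
  have "i \<in> {l \<in> {1..n}. fst (history n h l) = i}"
    using assms by (auto simp: follows_learner_def history_def arm_def)
  then have "0 < pulls n (history n h) i"
    unfolding pulls_def by (subst card_gt_0_iff) auto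
  moreover have "pulls n (history n h) i \<le> card {1..n}"
    unfolding pulls_def by (rule card_mono) auto
  ultimately show ?thesis by simp
qed

text \<open>An optimal arm has \<open>phi\<close> equal to 0, so a minimiser has nonpositive
  \<open>phi\<close>. This is a positive pull count times a nonnegative gap, hence the gap is
  0.\<close>

lemma argmin_phi_optimal:
  assumes "follows_learner K n h" "K \<le> n" "1 \<le> K"
    and i: "is_arg_min (phi K n h \<nu>) (\<lambda>i. i \<in> {1..K}) i"
  shows "i \<in> {1..K}" "mean_reward \<nu> i = opt_mean K \<nu>"
proof -
  show iK: "i \<in> {1..K}" using i by (simp add: is_arg_min_def)
  obtain b where b: "b \<in> {1..K}" "mean_reward \<nu> b = opt_mean K \<nu>"
    using opt_mean_attained[OF assms(3)] .
  have "phi K n h \<nu> i \<le> phi K n h \<nu> b"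
    using i b(1) by (auto simp: is_arg_min_def not_less)
  then have "real (pulls n (history n h) i) * (opt_mean K \<nu> - mean_reward \<nu> i) \<le> 0"
    by (simp add: follows_learner_phi[OF assms(1)] b(2))
  moreover have "0 < real (pulls n (history n h) i)"
    using follows_learner_pulls[OF assms(1,2) iK] by simp
  ultimately have "opt_mean K \<nu> \<le> mean_reward \<nu> i"
    by (simp add: mult_le_0_iff)
  then show "mean_reward \<nu> i = opt_mean K \<nu>"
    using opt_mean_ge[OF iK, of \<nu>] by simp
qed

text \<open>The played arm is optimal for the sampled environment, so only its two means under
  \<open>\<nu>'\<close> and \<open>\<nu>\<close> have to be compared. The empirical mean depends on
  the history alone and is close to both. The two widths, each at most \<open>4 * ln c\<close> times
  the difference of roots, give the constant 8.\<close>

lemma argmin_phi_gap: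
  assumes h: "follows_learner K n h" and n: "K \<le> n" "n \<le> T" and K: "1 \<le> K" and c: "1 \<le> c"
    and i: "is_arg_min (phi K n h \<nu>') (\<lambda>i. i \<in> {1..K}) i"
  defines "\<eta> \<equiv> history n h"
  defines "m \<equiv> real (pulls n \<eta> i)"
  shows "opt_mean K \<nu>' \<le> mean_reward \<nu> i + 8 * ln c * (sqrt (m + 1) - sqrt m)
     + exp_pot K (scales T) n \<nu>' \<eta> / c + exp_pot K (scales T) n \<nu> \<eta> / c"
proof -
  note iopt = argmin_phi_optimal[OF h n(1) K i]
  have pulls: "pulls n \<eta> i \<in> {1..T}"
    using follows_learner_pulls[OF h n(1) iopt(1)] n(2) by (simp add: \<eta>_def)
  have "mean_reward \<nu>' i - mean_reward \<nu> i \<le>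
    \<bar>emp_mean n \<eta> i - mean_reward \<nu>' i\<bar> + \<bar>emp_mean n \<eta> i - mean_reward \<nu> i\<bar>" by linarith
  also have "\<dots> \<le> (ln c / sqrt m + exp_pot K (scales T) n \<nu>' \<eta> / c)
      + (ln c / sqrt m + exp_pot K (scales T) n \<nu> \<eta> / c)"
    unfolding m_def using c by (intro add_mono emp_mean_deviation iopt(1) pulls) auto
  also have "ln c / sqrt m \<le> ln c * (4 * (sqrt (m + 1) - sqrt m))"
    using mult_left_mono[OF inverse_sqrt_le_diff[of m], of "ln c"] pulls c by (simp add: m_def)
  finally show ?thesis using iopt(2) by (simp add: algebra_simps)
qed

section \<open>The law of the process as a chain of one-step kernels\<close>

locale bms_fixed_arms =
  fixes K T :: nat and prior :: "env measure"
    and post :: "nat \<Rightarrow> history \<Rightarrow> env measure" and tie :: "nat \<Rightarrow> transcript \<times> env \<Rightarrow> nat measure"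
  assumes K: "1 \<le> K"
    and prior: "prior \<in> space (prob_algebra (env_space K))"
    and argmin: "\<And>n. K \<le> n \<Longrightarrow> n < T \<Longrightarrow> argmin_rule K K n (tie (Suc n))"
    and posterior: "is_posterior K K T (fixed_arm K) prior post tie"
begin

abbreviation X :: "nat \<Rightarrow> (env \<times> transcript) measure" where
  "X n \<equiv> env_space K \<Otimes>\<^sub>M transcript_space K K n"

abbreviation L :: "nat \<Rightarrow> (env \<times> transcript) measure" where
  "L n \<equiv> bms_law K K (fixed_arm K) prior post tie n"

abbreviation sel :: "nat \<Rightarrow> transcript \<Rightarrow> nat measure" where
  "sel n h \<equiv> bms_select K post tie n h"

text \<open>One round as a single Markov kernel. The point masses for the base learner and for the
  final transcript have been absorbed, so \<open>i\<close> is recorded both as learner and as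
  arm.\<close>

definition kern :: "nat \<Rightarrow> env \<times> transcript \<Rightarrow> (env \<times> transcript) measure" where
  "kern n z = sel n (snd z) \<bind>
     (\<lambda>i. distr (fst z i) (X (Suc n)) (\<lambda>r. (fst z, (snd z)(Suc n := (i, i, r)))))"

lemma rcd:
  "K \<le> n \<Longrightarrow> n < T \<Longrightarrow>
     regular_cond_distr (L n) (env_space K) fst (history_space K n) (\<lambda>z. history n (snd z)) (post (Suc n))"
  using posterior by (simp add: is_posterior_def case_prod_beta')

lemma measurable_post:
  "K \<le> n \<Longrightarrow> n < T \<Longrightarrow> post (Suc n) \<in> history_space K n \<rightarrow>\<^sub>M prob_algebra (env_space K)"
  using rcd by (simp add: regular_cond_distr_def)

lemma measurable_tie:
  "K \<le> n \<Longrightarrow> n < T \<Longrightarrow>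
     tie (Suc n) \<in> transcript_space K K n \<Otimes>\<^sub>M env_space K \<rightarrow>\<^sub>M prob_algebra (count_space {1..K})"
  using argmin by (simp add: argmin_rule_def)

text \<open>The round-robin phase gives a constant kernel. Later the kernel composes
  \<open>post\<close> with \<open>tie\<close>, whose measurability is known exactly for the rounds
  with \<open>n < T\<close>.\<close>

lemma measurable_sel:
  assumes "n < T"
  shows "sel n \<in> transcript_space K K n \<rightarrow>\<^sub>M prob_algebra (count_space {1..K})"
proof (cases "Suc n \<le> K")
  case True
  then have "return (count_space {1..K}) (Suc n) \<in> space (prob_algebra (count_space {1..K}))"
    by (simp add: space_prob_algebra prob_space_return)
  then show ?thesis using True by (simp add: bms_select_def[abs_def])
next
  case False
  then have n: "K \<le> n" by simp
  note [measurable] = measurable_post[OF n assms] measurable_tie[OF n assms]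
  have "(\<lambda>h. post (Suc n) (history n h) \<bind> (\<lambda>\<nu>'. tie (Suc n) (h, \<nu>')))
      \<in> transcript_space K K n \<rightarrow>\<^sub>M prob_algebra (count_space {1..K})"
    by (rule measurable_bind_prob_space2[where N="env_space K"]) measurable
  then show ?thesis using False by (simp add: bms_select_def[abs_def])
qed

lemma measurable_kern:
  assumes "n < T"
  shows "kern n \<in> X n \<rightarrow>\<^sub>M prob_algebra (X (Suc n))"
proof -
  note [measurable] = measurable_sel[OF assms]
  have "(\<lambda>z. sel n (snd z) \<bind>
     (\<lambda>i. distr (fst z i) (X (Suc n)) (\<lambda>r. (fst z, (snd z)(Suc n := (i, i, r))))))
     \<in> X n \<rightarrow>\<^sub>M prob_algebra (X (Suc n))"
  proof (rule measurable_bind_prob_space2[where N="count_space {1..K}"])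
    show "(\<lambda>z. sel n (snd z)) \<in> X n \<rightarrow>\<^sub>M prob_algebra (count_space {1..K})" by measurable
    show "(\<lambda>(z, i). distr (fst z i) (X (Suc n)) (\<lambda>r. (fst z, (snd z)(Suc n := (i, i, r)))))
      \<in> X n \<Otimes>\<^sub>M count_space {1..K} \<rightarrow>\<^sub>M prob_algebra (X (Suc n))"
      unfolding case_prod_beta'
    proof (rule measurable_distr_prob_space2[where M=reward_space])
      show "(\<lambda>w. fst (fst w) (snd w)) \<in> X n \<Otimes>\<^sub>M count_space {1..K} \<rightarrow>\<^sub>M prob_algebra reward_space"
        by (rule measurable_env_apply) measurable
      show "(\<lambda>(w, r). (fst (fst w), (snd (fst w))(Suc n := (snd w, snd w, r))))
        \<in> (X n \<Otimes>\<^sub>M count_space {1..K}) \<Otimes>\<^sub>M reward_space \<rightarrow>\<^sub>M X (Suc n)"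
        unfolding case_prod_beta' by (intro measurable_Pair measurable_transcript_upd) measurable
    qed
  qed
  then show ?thesis by (simp add: kern_def[abs_def])
qed

lemma sel_prob_space:
  assumes "n < T" "h \<in> space (transcript_space K K n)"
  shows "prob_space (sel n h)" "sets (sel n h) = sets (count_space {1..K})" "space (sel n h) = {1..K}"
proof -
  show "prob_space (sel n h)" and s: "sets (sel n h) = sets (count_space {1..K})"
    using measurable_space[OF measurable_sel[OF assms(1)] assms(2)] by (auto simp: space_prob_algebra)
  show "space (sel n h) = {1..K}" using sets_eq_imp_space_eq[OF s] by simp
qed

lemma measurable_reward_upd:
  assumes "\<nu> \<in> space (env_space K)" "h \<in> space (transcript_space K K n)"
    "i \<in> {1..K}" and a: "a \<in> {1..K}"
  shows "(\<lambda>r. (\<nu>, h(Suc n := (i, a, r)))) \<in> \<nu> a \<rightarrow>\<^sub>M X (Suc n)"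
proof -
  have "(\<lambda>r. (\<nu>, h(Suc n := (i, a, r)))) \<in> reward_space \<rightarrow>\<^sub>M X (Suc n)"
    using assms by (intro measurable_Pair measurable_transcript_upd measurable_const measurable_ident) simp_all
  then show ?thesis
    using env_arm_prob_space(2)[OF assms(1) a] by (simp cong: measurable_cong_sets)
qed

text \<open>The hypothesis \<open>S\<close> avoids circularity: the induction that places the law on
  the right space uses this equation and supplies \<open>S\<close> at each stage. Afterwards
  \<open>law_Suc\<close> is free of it.\<close>

lemma law_Suc_kern:
  assumes n: "n < T" and S: "space (L n) = space (X n)"
  shows "L (Suc n) = L n \<bind> kern n"
proof -
  have "L (Suc n) = L n \<bind> (\<lambda>(\<nu>, h). sel n h \<bind> (\<lambda>i. fixed_arm K i (Suc n) h \<bind>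
      (\<lambda>a. \<nu> a \<bind> (\<lambda>r. return (X (Suc n)) (\<nu>, h(Suc n := (i, a, r)))))))"
    by simp
  also have "\<dots> = L n \<bind> kern n"
  proof (rule bind_cong[OF refl])
    fix z assume "z \<in> space (L n)"
    then obtain \<nu> h where z: "z = (\<nu>, h)" and \<nu>: "\<nu> \<in> space (env_space K)"
      and h: "h \<in> space (transcript_space K K n)"
      unfolding S by (auto simp: space_pair_measure)
    have "fixed_arm K i (Suc n) h \<bind> (\<lambda>a. \<nu> a \<bind> (\<lambda>r. return (X (Suc n)) (\<nu>, h(Suc n := (i, a, r)))))
      = distr (\<nu> i) (X (Suc n)) (\<lambda>r. (\<nu>, h(Suc n := (i, i, r))))" if i: "i \<in> {1..K}" for i
    proof -
      note upd = measurable_reward_upd[OF \<nu> h i]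
      have eq: "\<nu> a \<bind> (\<lambda>r. return (X (Suc n)) (\<nu>, h(Suc n := (i, a, r))))
        = distr (\<nu> a) (X (Suc n)) (\<lambda>r. (\<nu>, h(Suc n := (i, a, r))))" if a: "a \<in> {1..K}" for a
      proof -
        interpret prob_space "\<nu> a" using env_arm_prob_space[OF \<nu> a] by simp
        show ?thesis
          by (rule bind_return_distr'[OF not_empty upd[OF a]])
      qed
      \<comment> \<open>Evaluating the bind at the point mass \<open>fixed_arm\<close> requires the
        continuation to be a kernel; on a countable discrete space this is a pointwise
        check.\<close>
      have "(\<lambda>a. \<nu> a \<bind> (\<lambda>r. return (X (Suc n)) (\<nu>, h(Suc n := (i, a, r)))))
          \<in> count_space {1..K} \<rightarrow>\<^sub>M subprob_algebra (X (Suc n))"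
      proof (rule measurable_count_space_eq1[THEN iffD2], rule Pi_I)
        fix a assume a: "a \<in> {1..K}"
        interpret prob_space "\<nu> a" using env_arm_prob_space[OF \<nu> a] by simp
        show "\<nu> a \<bind> (\<lambda>r. return (X (Suc n)) (\<nu>, h(Suc n := (i, a, r)))) \<in> space (subprob_algebra (X (Suc n)))"
          unfolding eq[OF a] using prob_space_distr[OF upd[OF a]]
          by (simp add: space_subprob_algebra prob_space_imp_subprob_space)
      qed
      then show ?thesis
        using i by (simp add: fixed_arm_def bind_return[where N="X (Suc n)"] eq)
    qed
    then show "(case z of (\<nu>, h) \<Rightarrow> sel n h \<bind> (\<lambda>i. fixed_arm K i (Suc n) h \<bind>
      (\<lambda>a. \<nu> a \<bind> (\<lambda>r. return (X (Suc n)) (\<nu>, h(Suc n := (i, a, r))))))) = kern n z"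
      unfolding z kern_def using sel_prob_space(3)[OF n h] by (auto intro!: bind_cong)
  qed
  finally show ?thesis .
qed

lemma law_in_prob_algebra: "n \<le> T \<Longrightarrow> L n \<in> space (prob_algebra (X n))"
proof (induction n)
  case 0
  have "(\<lambda>\<nu>. (\<nu>, \<lambda>l. undefined)) \<in> env_space K \<rightarrow>\<^sub>M X 0"
    by (intro measurable_Pair measurable_ident_sets measurable_const)
       (auto simp: transcript_space_def space_PiM)
  moreover have "sets prior = sets (env_space K)" "prob_space prior"
    using prior by (auto simp: space_prob_algebra)
  ultimately show ?case
    by (auto simp: space_prob_algebra intro!: prob_space.prob_space_distr cong: measurable_cong_sets)
next
  case (Suc n)
  then have n: "n < T" and L: "L n \<in> space (prob_algebra (X n))" by auto
  then have "space (L n) = space (X n)"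
    by (auto simp: space_prob_algebra dest: sets_eq_imp_space_eq)
  note eq = law_Suc_kern[OF n this]
  show ?case
    unfolding eq using prob_space_bind'[OF L measurable_kern[OF n]] sets_bind'[OF L measurable_kern[OF n]]
    by (simp add: space_prob_algebra)
qed

lemma law_prob_space: "n \<le> T \<Longrightarrow> prob_space (L n)"
  and sets_law: "n \<le> T \<Longrightarrow> sets (L n) = sets (X n)"
  and space_law: "n \<le> T \<Longrightarrow> space (L n) = space (X n)"
  using law_in_prob_algebra[of n] by (auto simp: space_prob_algebra dest: sets_eq_imp_space_eq)

lemma law_Suc: "n < T \<Longrightarrow> L (Suc n) = L n \<bind> kern n"
  by (intro law_Suc_kern) (simp_all add: space_law)

lemma measurable_law_cong: "n \<le> T \<Longrightarrow> L n \<rightarrow>\<^sub>M N = X n \<rightarrow>\<^sub>M N"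
  by (rule measurable_cong_sets) (simp_all add: sets_law)

lemma kern_step:
  assumes \<nu>: "\<nu> \<in> space (env_space K)" and h: "h \<in> space (transcript_space K K n)" and n: "n < T"
  shows "(\<lambda>i. distr (\<nu> i) (X (Suc n)) (\<lambda>r. (\<nu>, h(Suc n := (i, i, r)))))
     \<in> sel n h \<rightarrow>\<^sub>M prob_algebra (X (Suc n))"
proof -
  have "(\<lambda>i. distr (\<nu> i) (X (Suc n)) (\<lambda>r. (\<nu>, h(Suc n := (i, i, r)))))
     \<in> count_space {1..K} \<rightarrow>\<^sub>M prob_algebra (X (Suc n))"
  proof (rule measurable_count_space_eq1[THEN iffD2], rule Pi_I)
    fix i assume i: "i \<in> {1..K}"
    interpret prob_space "\<nu> i" using env_arm_prob_space[OF \<nu> i] by simp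
    show "distr (\<nu> i) (X (Suc n)) (\<lambda>r. (\<nu>, h(Suc n := (i, i, r)))) \<in> space (prob_algebra (X (Suc n)))"
      using prob_space_distr[OF measurable_reward_upd[OF \<nu> h i i]] by (simp add: space_prob_algebra)
  qed
  then show ?thesis
    by (subst measurable_cong_sets[OF sel_prob_space(2)[OF n h] refl])
qed

lemma kern_integral:
  fixes f :: "env \<times> transcript \<Rightarrow> real"
  assumes \<nu>: "\<nu> \<in> space (env_space K)" and h: "h \<in> space (transcript_space K K n)" and n: "n < T"
    and f: "f \<in> borel_measurable (X (Suc n))" "\<And>z. z \<in> space (X (Suc n)) \<Longrightarrow> \<bar>f z\<bar> \<le> B"
  shows "(\<integral>z. f z \<partial>kern n (\<nu>, h)) = (\<integral>i. (\<integral>r. f (\<nu>, h(Suc n := (i, i, r))) \<partial>\<nu> i) \<partial>sel n h)"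
    and "integrable (sel n h) (\<lambda>i. \<integral>r. f (\<nu>, h(Suc n := (i, i, r))) \<partial>\<nu> i)"
proof -
  note ps = sel_prob_space[OF n h]
  note b = prob_integral_bind[OF ps(1) kern_step[OF \<nu> h n] f]
  have d: "(\<integral>z. f z \<partial>distr (\<nu> i) (X (Suc n)) (\<lambda>r. (\<nu>, h(Suc n := (i, i, r)))))
    = (\<integral>r. f (\<nu>, h(Suc n := (i, i, r))) \<partial>\<nu> i)" if "i \<in> space (sel n h)" for i
    using that measurable_reward_upd[OF \<nu> h] f(1) unfolding ps(3) by (intro integral_distr) auto
  show "(\<integral>z. f z \<partial>kern n (\<nu>, h)) = (\<integral>i. (\<integral>r. f (\<nu>, h(Suc n := (i, i, r))) \<partial>\<nu> i) \<partial>sel n h)"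
    using b(1) d by (simp add: kern_def cong: Bochner_Integration.integral_cong)
  show "integrable (sel n h) (\<lambda>i. \<integral>r. f (\<nu>, h(Suc n := (i, i, r))) \<partial>\<nu> i)"
    using b(2) d by (simp cong: Bochner_Integration.integrable_cong)
qed

text \<open>Learner and arm agree by construction of \<open>kern\<close>. The round-robin clause
  holds because selection is a point mass for \<open>Suc n \<le> K\<close>, and it asks nothing of
  later rounds.\<close>

lemma AE_follows_learner: "n \<le> T \<Longrightarrow> AE z in L n. follows_learner K n (snd z)"
proof (induction n)
  case 0
  show ?case by (simp add: follows_learner_def)
next
  case (Suc n)
  then have n: "n < T" and IH: "AE z in L n. follows_learner K n (snd z)" by auto
  have kern: "kern n \<in> L n \<rightarrow>\<^sub>M subprob_algebra (X (Suc n))"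
    using measurable_kern[OF n] n by (simp add: measurable_law_cong measurable_prob_algebraD)
  have "AE z in L n. AE y in kern n z. follows_learner K (Suc n) (snd y)"
  proof (rule AE_mp[OF IH], rule AE_I2, rule impI)
    fix z assume "z \<in> space (L n)" and good: "follows_learner K n (snd z)"
    then obtain \<nu> h where z: "z = (\<nu>, h)" and \<nu>: "\<nu> \<in> space (env_space K)"
      and h: "h \<in> space (transcript_space K K n)"
      using n by (auto simp: space_law space_pair_measure)
    have sel: "AE i in sel n h. Suc n \<le> K \<longrightarrow> i = Suc n"
    proof (cases "Suc n \<le> K")
      case True
      then have eq: "sel n h = return (count_space {1..K}) (Suc n)"
        by (simp add: bms_select_def)
      show ?thesis
        unfolding eq using True by (subst AE_return) auto
    next
      case False
      then show ?thesis by (intro AE_I2) simp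
    qed
    have "AE i in sel n h. AE y in distr (\<nu> i) (X (Suc n)) (\<lambda>r. (\<nu>, h(Suc n := (i, i, r)))).
        follows_learner K (Suc n) (snd y)"
    proof (rule AE_mp[OF sel], rule AE_I2, rule impI)
      fix i assume "i \<in> space (sel n h)" and i: "Suc n \<le> K \<longrightarrow> i = Suc n"
      then have iK: "i \<in> {1..K}" using sel_prob_space(3)[OF n h] by simp
      show "AE y in distr (\<nu> i) (X (Suc n)) (\<lambda>r. (\<nu>, h(Suc n := (i, i, r)))).
        follows_learner K (Suc n) (snd y)"
        using follows_learner_upd[OF good i] z
        by (subst AE_distr_iff[OF measurable_reward_upd[OF \<nu> h iK iK]]) auto
    qed
    then show "AE y in kern n z. follows_learner K (Suc n) (snd y)"
      unfolding kern_def z fst_conv snd_conv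
      by (subst AE_bind[OF measurable_prob_algebraD[OF kern_step[OF \<nu> h n]]]) auto
  qed
  then show ?case
    unfolding law_Suc[OF n] by (subst AE_bind[OF kern]) auto
qed


subsection \<open>Regret\<close>

definition \<Phi> :: "nat \<Rightarrow> env \<times> transcript \<Rightarrow> real" where
  "\<Phi> n z = exp_pot K (scales T) n (fst z) (history n (snd z))"

definition regret :: "nat \<Rightarrow> env \<times> transcript \<Rightarrow> real" where
  "regret n z = (\<Sum>t=1..n. opt_mean K (fst z) - mean_reward (fst z) (arm (snd z) t))"

definition V :: "nat \<Rightarrow> env \<times> transcript \<Rightarrow> real" where
  "V n z = sqrt_pulls K n (history n (snd z))"

lemma history_in_space:
  "h \<in> space (transcript_space K K n) \<Longrightarrow> history n h \<in> space (history_space K n)"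
  by (rule measurable_space[OF measurable_history])

lemma measurable_\<Phi>: "\<Phi> n \<in> borel_measurable (X n)"
proof -
  have "(\<lambda>z. (fst z, history n (snd z))) \<in> X n \<rightarrow>\<^sub>M env_space K \<Otimes>\<^sub>M history_space K n"
    by measurable
  from measurable_compose[OF this measurable_exp_pot] show ?thesis
    by (simp add: \<Phi>_def[abs_def])
qed

lemma \<Phi>_bounded:
  obtains B where "\<And>z. z \<in> space (X n) \<Longrightarrow> \<bar>\<Phi> n z\<bar> \<le> B"
proof
  fix z assume "z \<in> space (X n)"
  then have "exp_pot K (scales T) n (fst z) (history n (snd z)) \<le> real K * (real (card (scales T)) * exp (real n))"
    by (intro exp_pot_le scales_subset history_in_space) (auto simp: space_pair_measure)
  then show "\<bar>\<Phi> n z\<bar> \<le> real K * (real (card (scales T)) * exp (real n))"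
    by (simp add: \<Phi>_def exp_pot_nonneg)
qed

lemma measurable_V: "V n \<in> borel_measurable (X n)"
proof -
  have [measurable]: "Measurable.pred (X n) (\<lambda>z. fst (history n (snd z) l) = a)" if "l \<in> {1..n}" for l a
  proof -
    have "(\<lambda>z. fst (history n (snd z) l)) \<in> X n \<rightarrow>\<^sub>M count_space {1..K}"
      by (rule measurable_history_component[OF _ that]) measurable
    from measurable_compose[OF this, of "\<lambda>x. x = a" "count_space UNIV"] show ?thesis by simp
  qed
  \<comment> \<open>A cardinality becomes a finite sum of indicators, whose measurability is
    immediate.\<close>
  have "real (pulls n (history n (snd z)) a) = (\<Sum>l\<in>{1..n}. if fst (history n (snd z) l) = a then 1 else 0)" for z a
    by (simp add: pulls_def sum.If_cases Int_def)
  note eq = this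
  show ?thesis
    unfolding V_def[abs_def] sqrt_pulls_def eq by measurable
qed

lemma V_bounds: "0 \<le> V n z" "V n z \<le> sqrt (real K * real n)"
  by (simp_all add: V_def sqrt_pulls_bounds)

lemma measurable_regret: "regret n \<in> borel_measurable (X n)"
proof -
  have [measurable]: "(\<lambda>z. mean_reward (fst z) (arm (snd z) t)) \<in> borel_measurable (X n)" if "t \<in> {1..n}" for t
    by (rule measurable_mean_reward[where K=K, OF measurable_fst
          measurable_compose[OF measurable_snd measurable_arm[OF that]]])
  show ?thesis
    unfolding regret_def[abs_def] by measurable
qed

lemma arm_in_range:
  "h \<in> space (transcript_space K K n) \<Longrightarrow> t \<in> {1..n} \<Longrightarrow> arm h t \<in> {1..K}"
  using measurable_space[OF measurable_arm] by fastforce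

lemma regret_bounds:
  assumes "z \<in> space (X n)"
  shows "0 \<le> regret n z" "regret n z \<le> real n"
proof -
  have \<nu>: "fst z \<in> space (env_space K)" and h: "snd z \<in> space (transcript_space K K n)"
    using assms by (auto simp: space_pair_measure)
  have "0 \<le> opt_mean K (fst z) - mean_reward (fst z) (arm (snd z) t)"
    "opt_mean K (fst z) - mean_reward (fst z) (arm (snd z) t) \<le> 1" if "t \<in> {1..n}" for t
    using arm_in_range[OF h that] opt_mean_ge[of _ K "fst z"] mean_reward_bounds[OF \<nu>]
      opt_mean_bounds[OF K \<nu>] by (fastforce intro: order_trans)+
  then have "0 \<le> regret n z" "regret n z \<le> (\<Sum>t=1..n. 1)"
    unfolding regret_def by (intro sum_nonneg sum_mono; blast)+
  then show "0 \<le> regret n z" "regret n z \<le> real n" by auto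
qed

lemma regret_upd:
  "regret (Suc n) (\<nu>, h(Suc n := (i, i, r))) = regret n (\<nu>, h) + (opt_mean K \<nu> - mean_reward \<nu> i)"
  by (simp add: regret_def arm_upd)

lemma V_upd:
  assumes "i \<in> {1..K}"
  shows "V (Suc n) (\<nu>, h(Suc n := (i, i, r))) = V n (\<nu>, h) +
     (sqrt (real (pulls n (history n h) i) + 1) - sqrt (real (pulls n (history n h) i)))"
  using assms by (simp add: V_def history_Suc_upd sqrt_pulls_Suc)

section \<open>Expectations of regret and potentials from one round to the next\<close>

lemma law_integrable:
  fixes f :: "env \<times> transcript \<Rightarrow> real"
  assumes "n \<le> T" "f \<in> borel_measurable (X n)" "\<And>z. z \<in> space (X n) \<Longrightarrow> \<bar>f z\<bar> \<le> B"
  shows "integrable (L n) f"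
  using assms by (intro prob_integrable_bounded[where B=B] law_prob_space) (auto simp: measurable_law_cong space_law)

lemma law_Suc_integral:
  fixes f :: "env \<times> transcript \<Rightarrow> real"
  assumes n: "n < T" and f: "f \<in> borel_measurable (X (Suc n))" "\<And>z. z \<in> space (X (Suc n)) \<Longrightarrow> \<bar>f z\<bar> \<le> B"
  shows "(\<integral>z. f z \<partial>L (Suc n)) = (\<integral>z. (\<integral>y. f y \<partial>kern n z) \<partial>L n)"
    and "integrable (L n) (\<lambda>z. \<integral>y. f y \<partial>kern n z)"
proof -
  have kern: "kern n \<in> L n \<rightarrow>\<^sub>M prob_algebra (X (Suc n))"
    using measurable_kern[OF n] n by (simp add: measurable_law_cong)
  have "prob_space (L n)" using n by (intro law_prob_space) simp
  note b = prob_integral_bind[OF this kern f]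
  show "(\<integral>z. f z \<partial>L (Suc n)) = (\<integral>z. (\<integral>y. f y \<partial>kern n z) \<partial>L n)"
    unfolding law_Suc[OF n] by (rule b(1))
  show "integrable (L n) (\<lambda>z. \<integral>y. f y \<partial>kern n z)" by (rule b(2))
qed

lemma integrable_\<Phi>: "n \<le> T \<Longrightarrow> integrable (L n) (\<Phi> n)"
  using \<Phi>_bounded[of n] by (metis law_integrable measurable_\<Phi>)

lemma integrable_V: "n \<le> T \<Longrightarrow> integrable (L n) (V n)"
  using V_bounds by (intro law_integrable[where B="sqrt (real K * real n)"] measurable_V) auto

lemma integrable_regret: "n \<le> T \<Longrightarrow> integrable (L n) (regret n)"
  using regret_bounds by (intro law_integrable[where B="real n"] measurable_regret) auto

text \<open>The conditional bound for a fixed arm survives averaging over the selection and the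
  environment. The initial value counts pairs of an arm and a scale, since all weights start at
  1.\<close>

lemma \<Phi>_expectation: "n \<le> T \<Longrightarrow> (\<integral>z. \<Phi> n z \<partial>L n) \<le> 2 * real K * real T"
proof (induction n)
  case 0
  interpret prob_space "L 0" by (rule law_prob_space) simp
  have "(\<integral>z. \<Phi> 0 z \<partial>L 0) = real K * real (card (scales T))"
    by (simp add: \<Phi>_def exp_pot_def log_weight_def prob_space del: bms_law.simps)
  also have "\<dots> \<le> real K * real (2 * T)"
    using card_scales[of T] by (intro mult_left_mono) (simp_all only: of_nat_le_iff of_nat_0_le_iff)
  finally show ?case by simp
next
  case (Suc n)
  then have n: "n < T" by simp
  obtain B where B: "\<And>z. z \<in> space (X (Suc n)) \<Longrightarrow> \<bar>\<Phi> (Suc n) z\<bar> \<le> B"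
    using \<Phi>_bounded by blast
  note step = law_Suc_integral[OF n measurable_\<Phi> B]
  have "(\<integral>z. \<Phi> (Suc n) z \<partial>L (Suc n)) = (\<integral>z. (\<integral>y. \<Phi> (Suc n) y \<partial>kern n z) \<partial>L n)"
    by (rule step)
  also have "\<dots> \<le> (\<integral>z. \<Phi> n z \<partial>L n)"
  proof (rule integral_mono)
    show "integrable (L n) (\<lambda>z. \<integral>y. \<Phi> (Suc n) y \<partial>kern n z)" by (rule step)
    show "integrable (L n) (\<Phi> n)" using n by (intro integrable_\<Phi>) simp
    fix z assume "z \<in> space (L n)"
    then obtain \<nu> h where z: "z = (\<nu>, h)" and \<nu>: "\<nu> \<in> space (env_space K)"
      and h: "h \<in> space (transcript_space K K n)"
      using n by (auto simp: space_law space_pair_measure)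
    note ps = sel_prob_space[OF n h]
    interpret prob_space "sel n h" by (rule ps)
    note ki = kern_integral[OF \<nu> h n measurable_\<Phi> B]
    have "(\<integral>y. \<Phi> (Suc n) y \<partial>kern n (\<nu>, h)) = (\<integral>i. (\<integral>r. \<Phi> (Suc n) (\<nu>, h(Suc n := (i, i, r))) \<partial>\<nu> i) \<partial>sel n h)"
      by (rule ki)
    also have "\<dots> \<le> \<Phi> n (\<nu>, h)"
    proof (intro integral_le_const AE_I2)
      show "integrable (sel n h) (\<lambda>i. \<integral>r. \<Phi> (Suc n) (\<nu>, h(Suc n := (i, i, r))) \<partial>\<nu> i)"
        by (rule ki)
      fix i assume "i \<in> space (sel n h)"
      then have "i \<in> {1..K}" using ps by simp
      from exp_pot_supermartingale[OF \<nu> this scales_subset]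
      show "(\<integral>r. \<Phi> (Suc n) (\<nu>, h(Suc n := (i, i, r))) \<partial>\<nu> i) \<le> \<Phi> n (\<nu>, h)"
        by (simp add: \<Phi>_def history_Suc_upd)
    qed
    finally show "(\<integral>y. \<Phi> (Suc n) y \<partial>kern n z) \<le> \<Phi> n z" by (simp add: z)
  qed
  also have "\<dots> \<le> 2 * real K * real T" using Suc by simp
  finally show ?case .
qed

text \<open>
  The posterior enters only here: in expectation, the optimal mean and the potential of the sampled
  environment may be replaced by those of the true one.
\<close>
lemma regret_step:
  assumes Kn: "K \<le> n" and n: "n < T" and c: "1 \<le> c"
  shows "(\<integral>z. regret (Suc n) z - 8 * ln c * V (Suc n) z \<partial>L (Suc n))
     \<le> (\<integral>z. regret n z - 8 * ln c * V n z \<partial>L n) + 2 * (\<integral>z. \<Phi> n z \<partial>L n) / c"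
proof -
  \<comment> \<open>Subtracting \<open>V\<close> pays for the confidence widths of the played arms;
    the coefficient is the one in \<open>argmin_phi_gap\<close>.\<close>
  define F where "F = (\<lambda>n z. regret n z - 8 * ln c * V n z)"
  \<comment> \<open>What \<open>argmin_phi_gap\<close> provides on the side of the sampled
    environment. It sees the transcript only through the history, so the posterior identity applies
    to it.\<close>
  define g where "g = (\<lambda>\<nu> \<eta>. opt_mean K \<nu> - exp_pot K (scales T) n \<nu> \<eta> / c)"
  define P where "P = (\<lambda>h. \<integral>\<nu>'. g \<nu>' (history n h) \<partial>post (Suc n) (history n h))"
  have nT: "n \<le> T" using n by simp
  have lnc: "0 \<le> ln c" using c by simp
  interpret Ln: prob_space "L n" by (rule law_prob_space[OF nT])
  have F_meas: "F k \<in> borel_measurable (X k)" for k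
    using measurable_regret[of k] measurable_V[of k] by (simp add: F_def)
  have F_bnd: "\<bar>F k z\<bar> \<le> real k + 8 * ln c * sqrt (real K * real k)" if "z \<in> space (X k)" for k z
  proof -
    have "0 \<le> 8 * ln c * V k z" "8 * ln c * V k z \<le> 8 * ln c * sqrt (real K * real k)"
      using V_bounds[of k z] lnc by (auto intro!: mult_left_mono)
    then show ?thesis
      using regret_bounds[OF that] by (simp add: F_def abs_le_iff)
  qed
  have intF: "integrable (L n) (F n)"
    using integrable_regret[OF nT] integrable_V[OF nT] by (simp add: F_def)
  obtain BP where BP: "\<And>\<nu> \<eta>. \<nu> \<in> space (env_space K) \<Longrightarrow> \<eta> \<in> space (history_space K n) \<Longrightarrow>
      exp_pot K (scales T) n \<nu> \<eta> \<le> BP"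
    using exp_pot_le scales_subset by blast
  have g_bnd: "\<bar>g \<nu> \<eta>\<bar> \<le> 1 + BP" if "\<nu> \<in> space (env_space K)" "\<eta> \<in> space (history_space K n)" for \<nu> \<eta>
  proof -
    have "0 \<le> exp_pot K (scales T) n \<nu> \<eta> / c" "exp_pot K (scales T) n \<nu> \<eta> / c \<le> exp_pot K (scales T) n \<nu> \<eta>"
      using c exp_pot_nonneg[of K "scales T" n \<nu> \<eta>] by (auto simp: divide_le_eq intro: mult_right_mono[of 1 c, simplified, THEN order_trans])
    then show ?thesis
      using BP[OF that] opt_mean_bounds[OF K that(1)] by (simp add: g_def abs_le_iff)
  qed
  have g_meas: "(\<lambda>(\<nu>, \<eta>). g \<nu> \<eta>) \<in> borel_measurable (env_space K \<Otimes>\<^sub>M history_space K n)"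
    using measurable_exp_pot[of K "scales T" n] unfolding g_def case_prod_beta' by measurable
  note bayes = regular_cond_distr_integral[OF law_prob_space[OF nT] rcd[OF Kn n] g_meas g_bnd]
  have int_opt: "integrable (L n) (\<lambda>z. opt_mean K (fst z))"
    using opt_mean_bounds[OF K]
    by (intro law_integrable[OF nT, where B=1]) (auto simp: space_pair_measure)
  have intP: "integrable (L n) (\<lambda>z. P (snd z))"
    using bayes(1) by (simp add: P_def)
  \<comment> \<open>Posterior sampling: on average over histories, the sampled environment inside
    \<open>P\<close> may be exchanged for the true one.\<close>
  have "(\<integral>z. P (snd z) \<partial>L n) = (\<integral>z. g (fst z) (history n (snd z)) \<partial>L n)"
    using bayes(2) by (simp add: P_def)
  also have "\<dots> = (\<integral>z. opt_mean K (fst z) - \<Phi> n z / c \<partial>L n)"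
    by (simp add: g_def \<Phi>_def)
  also have "\<dots> = (\<integral>z. opt_mean K (fst z) \<partial>L n) - (\<integral>z. \<Phi> n z \<partial>L n) / c"
    using int_opt integrable_\<Phi>[OF nT] by simp
  finally have P_eq: "(\<integral>z. P (snd z) \<partial>L n) = (\<integral>z. opt_mean K (fst z) \<partial>L n) - (\<integral>z. \<Phi> n z \<partial>L n) / c" .
  note step = law_Suc_integral[OF n F_meas F_bnd]
  have "(\<integral>z. F (Suc n) z \<partial>L (Suc n)) = (\<integral>z. (\<integral>y. F (Suc n) y \<partial>kern n z) \<partial>L n)"
    by (rule step)
  also have "\<dots> \<le> (\<integral>z. F n z + opt_mean K (fst z) - P (snd z) + \<Phi> n z / c \<partial>L n)"
  proof (rule integral_mono_AE)
    show "integrable (L n) (\<lambda>z. \<integral>y. F (Suc n) y \<partial>kern n z)" by (rule step)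
    show "integrable (L n) (\<lambda>z. F n z + opt_mean K (fst z) - P (snd z) + \<Phi> n z / c)"
      using intF int_opt intP integrable_\<Phi>[OF nT] by simp
    show "AE z in L n. (\<integral>y. F (Suc n) y \<partial>kern n z) \<le> F n z + opt_mean K (fst z) - P (snd z) + \<Phi> n z / c"
      using AE_follows_learner[OF nT]
    proof (rule AE_mp, intro AE_I2 impI)
      fix z assume "z \<in> space (L n)" and "follows_learner K n (snd z)"
      then obtain \<nu> h where z: "z = (\<nu>, h)" and \<nu>: "\<nu> \<in> space (env_space K)"
        and h: "h \<in> space (transcript_space K K n)" and good: "follows_learner K n h"
        using nT by (auto simp: space_law space_pair_measure)
      define \<eta> where "\<eta> = history n h"
      have \<eta>: "\<eta> \<in> space (history_space K n)" using history_in_space[OF h] by (simp add: \<eta>_def)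
      \<comment> \<open>Playing arm \<open>i\<close> changes \<open>F\<close> by
        \<open>opt_mean K \<nu> - G i\<close>, whatever the reward is. It remains to bound the mean
        of \<open>G\<close> from below.\<close>
      define G where "G = (\<lambda>i. mean_reward \<nu> i + 8 * ln c *
        (sqrt (real (pulls n \<eta> i) + 1) - sqrt (real (pulls n \<eta> i))))"
      define BG where "BG = Max ((\<lambda>i. \<bar>G i\<bar>) ` {1..K})"
      have G_bnd: "\<bar>G i\<bar> \<le> BG" if "i \<in> space (count_space {1..K})" for i
        using that by (simp add: BG_def)
      have G_meas: "G \<in> borel_measurable (count_space {1..K})" by simp
      note ps = sel_prob_space[OF n h]
      interpret sel: prob_space "sel n h" by (rule ps)
      have intG: "integrable (sel n h) G"
      proof (rule prob_integrable_bounded[OF ps(1), where B=BG])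
        show "G \<in> borel_measurable (sel n h)"
          using G_meas by (subst measurable_cong_sets[OF ps(2) refl])
      qed (use G_bnd ps(3) in simp)
      have F_upd: "F (Suc n) (\<nu>, h(Suc n := (i, i, r))) = F n (\<nu>, h) + opt_mean K \<nu> - G i"
        if "i \<in> {1..K}" for i r
        using that by (simp add: F_def regret_upd V_upd G_def \<eta>_def algebra_simps)
      have "(\<integral>y. F (Suc n) y \<partial>kern n (\<nu>, h))
          = (\<integral>i. (\<integral>r. F (Suc n) (\<nu>, h(Suc n := (i, i, r))) \<partial>\<nu> i) \<partial>sel n h)"
        by (rule kern_integral[OF \<nu> h n F_meas F_bnd])
      also have "\<dots> = (\<integral>i. F n (\<nu>, h) + opt_mean K \<nu> - G i \<partial>sel n h)"
      proof (rule Bochner_Integration.integral_cong[OF refl])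
        fix i assume "i \<in> space (sel n h)"
        then have i: "i \<in> {1..K}" using ps(3) by simp
        interpret prob_space "\<nu> i" using env_arm_prob_space[OF \<nu> i] by simp
        show "(\<integral>r. F (Suc n) (\<nu>, h(Suc n := (i, i, r))) \<partial>\<nu> i) = F n (\<nu>, h) + opt_mean K \<nu> - G i"
          using i by (simp add: F_upd prob_space)
      qed
      also have "\<dots> = F n (\<nu>, h) + opt_mean K \<nu> - (\<integral>i. G i \<partial>sel n h)"
        using intG by (simp add: sel.prob_space)
      finally have lhs: "(\<integral>y. F (Suc n) y \<partial>kern n (\<nu>, h)) = F n (\<nu>, h) + opt_mean K \<nu> - (\<integral>i. G i \<partial>sel n h)" .
      define post_n where "post_n = post (Suc n) \<eta>"
      have post: "prob_space post_n" "sets post_n = sets (env_space K)"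
        using measurable_space[OF measurable_post[OF Kn n] \<eta>] by (auto simp: space_prob_algebra post_n_def)
      then have post_space: "space post_n = space (env_space K)" by (auto dest: sets_eq_imp_space_eq)
      have tie: "(\<lambda>\<nu>'. tie (Suc n) (h, \<nu>')) \<in> post_n \<rightarrow>\<^sub>M prob_algebra (count_space {1..K})"
      proof -
        have "(\<lambda>\<nu>'. tie (Suc n) (h, \<nu>')) \<in> env_space K \<rightarrow>\<^sub>M prob_algebra (count_space {1..K})"
          using measurable_compose[OF measurable_Pair1'[OF h] measurable_tie[OF Kn n]] .
        then show ?thesis by (subst measurable_cong_sets[OF post(2) refl])
      qed
      interpret post: prob_space post_n by (rule post)
      have sel_eq: "sel n h = post_n \<bind> (\<lambda>\<nu>'. tie (Suc n) (h, \<nu>'))"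
        using Kn by (simp add: bms_select_def post_n_def \<eta>_def)
      note bG = prob_integral_bind[OF post(1) tie G_meas G_bnd]
      have intg: "integrable post_n (\<lambda>\<nu>'. g \<nu>' \<eta>)"
      proof (rule prob_integrable_bounded[OF post(1), where B="1 + BP"])
        have "(\<lambda>\<nu>'. g \<nu>' \<eta>) \<in> borel_measurable (env_space K)"
          using measurable_compose[OF measurable_Pair2'[OF \<eta>] g_meas] by simp
        then show "(\<lambda>\<nu>'. g \<nu>' \<eta>) \<in> borel_measurable post_n"
          by (subst measurable_cong_sets[OF post(2) refl])
      qed (use g_bnd \<eta> post_space in auto)
      \<comment> \<open>Selection draws from the posterior and then from \<open>tie\<close>. For
        each sampled environment, almost every choice is a minimiser and satisfies the gap bound,
        which is integrated over both draws.\<close>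
      have "P h - \<Phi> n (\<nu>, h) / c = (\<integral>\<nu>'. g \<nu>' \<eta> - \<Phi> n (\<nu>, h) / c \<partial>post_n)"
        using intg by (simp add: P_def \<eta>_def[symmetric] post_n_def[symmetric] post.prob_space)
      also have "\<dots> \<le> (\<integral>\<nu>'. (\<integral>i. G i \<partial>tie (Suc n) (h, \<nu>')) \<partial>post_n)"
      proof (rule integral_mono)
        show "integrable post_n (\<lambda>\<nu>'. g \<nu>' \<eta> - \<Phi> n (\<nu>, h) / c)" using intg by simp
        show "integrable post_n (\<lambda>\<nu>'. \<integral>i. G i \<partial>tie (Suc n) (h, \<nu>'))" by (rule bG)
        fix \<nu>' assume "\<nu>' \<in> space post_n"
        then have \<nu>': "\<nu>' \<in> space (env_space K)" by (simp add: post_space)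
        have ts: "prob_space (tie (Suc n) (h, \<nu>'))" "sets (tie (Suc n) (h, \<nu>')) = sets (count_space {1..K})"
          using measurable_space[OF tie \<open>\<nu>' \<in> space post_n\<close>] by (auto simp: space_prob_algebra)
        interpret tie: prob_space "tie (Suc n) (h, \<nu>')" by (rule ts)
        have "integrable (tie (Suc n) (h, \<nu>')) G"
        proof (rule prob_integrable_bounded[OF ts(1), where B=BG])
          show "G \<in> borel_measurable (tie (Suc n) (h, \<nu>'))"
            using G_meas by (subst measurable_cong_sets[OF ts(2) refl])
        qed (use G_bnd sets_eq_imp_space_eq[OF ts(2)] in simp)
        then show "g \<nu>' \<eta> - \<Phi> n (\<nu>, h) / c \<le> (\<integral>i. G i \<partial>tie (Suc n) (h, \<nu>'))"
        proof (rule tie.integral_ge_const)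
          have "AE i in tie (Suc n) (h, \<nu>'). is_arg_min (phi K n h \<nu>') (\<lambda>i. i \<in> {1..K}) i"
            using argmin[OF Kn n] h \<nu>' by (simp add: argmin_rule_def)
          then show "AE i in tie (Suc n) (h, \<nu>'). g \<nu>' \<eta> - \<Phi> n (\<nu>, h) / c \<le> G i"
          proof (rule AE_mp, intro AE_I2 impI)
            fix i assume "is_arg_min (phi K n h \<nu>') (\<lambda>i. i \<in> {1..K}) i"
            from argmin_phi_gap[OF good Kn nT K c this, of \<nu>]
            show "g \<nu>' \<eta> - \<Phi> n (\<nu>, h) / c \<le> G i"
              by (simp add: g_def G_def \<Phi>_def \<eta>_def)
          qed
        qed
      qed
      also have "\<dots> = (\<integral>i. G i \<partial>sel n h)"
        unfolding sel_eq by (rule bG(1)[symmetric])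
      finally show "(\<integral>y. F (Suc n) y \<partial>kern n z) \<le> F n z + opt_mean K (fst z) - P (snd z) + \<Phi> n z / c"
        unfolding z lhs by simp
    qed
  qed
  also have "\<dots> = (\<integral>z. F n z \<partial>L n) + (\<integral>z. opt_mean K (fst z) \<partial>L n) - (\<integral>z. P (snd z) \<partial>L n)
      + (\<integral>z. \<Phi> n z \<partial>L n) / c"
    using intF int_opt intP integrable_\<Phi>[OF nT] by simp
  \<comment> \<open>The optimal means cancel. One copy of the potential comes from the true
    environment, the other from the sampled one through \<open>P_eq\<close>.\<close>
  also have "\<dots> = (\<integral>z. F n z \<partial>L n) + 2 * (\<integral>z. \<Phi> n z \<partial>L n) / c"
    by (simp add: P_eq)
  finally show ?thesis by (simp add: F_def)
qed

section \<open>Summing over the rounds\<close>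

lemma regret_le_rounds: "n \<le> T \<Longrightarrow> (\<integral>z. regret n z \<partial>L n) \<le> real n"
proof -
  assume n: "n \<le> T"
  interpret prob_space "L n" by (rule law_prob_space[OF n])
  show ?thesis
    using integrable_regret[OF n] regret_bounds(2) n
    by (intro integral_le_const AE_I2) (simp_all add: space_law)
qed

lemma bayes_regret_eq: "bayes_regret K K T (fixed_arm K) prior post tie = (\<integral>z. regret T z \<partial>L T)"
  by (simp add: bayes_regret_def regret_def case_prod_beta')

lemma bayes_regret_bound:
  assumes T: "1 \<le> T"
  shows "bayes_regret K K T (fixed_arm K) prior post tie \<le> 22 * ln (2 * real K * real T) * sqrt (real K * real T)"
proof -
  define \<Lambda> where "\<Lambda> = ln (2 * real K * real T)"
  define S where "S = sqrt (real K * real T)"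
  have KT: "1 \<le> real K * real T"
    using K T by (metis mult_mono' mult_1 of_nat_1 of_nat_le_iff zero_le_one)
  have "ln 2 \<le> \<Lambda>"
    using KT by (simp add: \<Lambda>_def)
  \<comment> \<open>A lower bound on the logarithm lets terms of order \<open>S\<close> be absorbed
    into \<open>\<Lambda> * S\<close>.\<close>
  then have \<Lambda>: "1 / 2 \<le> \<Lambda>"
    using ln2_ge_two_thirds by linarith
  have S: "0 \<le> S" by (simp add: S_def)
  have \<Lambda>S: "S \<le> 2 * \<Lambda> * S"
    using mult_right_mono[OF \<Lambda> S] by linarith
  have "(\<integral>z. regret T z \<partial>L T) \<le> 22 * \<Lambda> * S"
  proof (cases "T \<le> K")
    case True
    \<comment> \<open>With at most as many rounds as arms, the trivial bound \<open>T\<close> is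
      already below \<open>S\<close>.\<close>
    have "(\<integral>z. regret T z \<partial>L T) \<le> real T" by (rule regret_le_rounds) simp
    also have "\<dots> = sqrt (real T * real T)" by simp
    also have "\<dots> \<le> S" unfolding S_def using True by (intro real_sqrt_le_mono mult_right_mono) auto
    finally show ?thesis using \<Lambda>S S by linarith
  next
    case False
    then have KT': "K \<le> T" by simp
    \<comment> \<open>As the expected potential is at most \<open>2 * K * T\<close>, this choice
      makes its contribution \<open>2 / T\<close> per round, hence at most 2 in total, while
      \<open>ln c\<close> stays within twice \<open>\<Lambda>\<close>.\<close>
    define c where "c = 2 * real K * real T * real T"
    have T0: "0 < real T" and K0: "0 < real K" using T K by auto
    have c1: "1 \<le> c"
    proof -
      have "1 * 1 \<le> (real K * real T) * real T" using KT T by (intro mult_mono) auto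
      then show ?thesis by (simp add: c_def)
    qed
    have lnc: "0 \<le> ln c" "ln c \<le> 2 * \<Lambda>"
    proof -
      show "0 \<le> ln c" using c1 by simp
      have "ln c = \<Lambda> + ln (real T)"
        using T0 K0 by (simp add: c_def \<Lambda>_def ln_mult)
      also have "ln (real T) \<le> \<Lambda>"
      proof -
        have "1 * real T \<le> (2 * real K) * real T" using K by (intro mult_right_mono) auto
        then show ?thesis unfolding \<Lambda>_def using T0 K0 by simp
      qed
      finally show "ln c \<le> 2 * \<Lambda>" by simp
    qed
    \<comment> \<open>The induction starts at \<open>K\<close>: round-robin exploration costs at
      most 1 per round, and there \<open>V\<close> is dropped by its sign.\<close>
    have main: "(\<integral>z. regret n z - 8 * ln c * V n z \<partial>L n) \<le> real K + (real n - real K) * (2 / real T)"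
      if "K \<le> n" "n \<le> T" for n
      using that
    proof (induction n rule: dec_induct)
      case base
      have "(\<integral>z. regret K z - 8 * ln c * V K z \<partial>L K) \<le> (\<integral>z. regret K z \<partial>L K)"
        using integrable_regret[OF KT'] integrable_V[OF KT'] lnc(1) V_bounds(1)
        by (intro integral_mono) auto
      also have "\<dots> \<le> real K" by (rule regret_le_rounds[OF KT'])
      finally show ?case by simp
    next
      case (step n)
      then have n: "n < T" by simp
      have "2 * (\<integral>z. \<Phi> n z \<partial>L n) / c \<le> 2 * (2 * real K * real T) / c"
        using \<Phi>_expectation[of n] n c1 by (intro divide_right_mono mult_left_mono) auto
      also have "\<dots> = 2 / real T" using T0 K0 by (simp add: c_def)
      finally have "2 * (\<integral>z. \<Phi> n z \<partial>L n) / c \<le> 2 / real T" .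
      then have "(\<integral>z. regret (Suc n) z - 8 * ln c * V (Suc n) z \<partial>L (Suc n))
          \<le> real K + (real n - real K) * (2 / real T) + 2 / real T"
        using regret_step[OF step(1) n c1] step n by linarith
      also have "\<dots> = real K + (real (Suc n) - real K) * (2 / real T)"
        unfolding of_nat_Suc by argo
      finally show ?case .
    qed
    interpret prob_space "L T" by (rule law_prob_space) simp
    have "(\<integral>z. V T z \<partial>L T) \<le> S"
      unfolding S_def using integrable_V[of T] V_bounds(2)
      by (intro integral_le_const AE_I2) auto
    then have "8 * ln c * (\<integral>z. V T z \<partial>L T) \<le> 8 * (2 * \<Lambda>) * S"
      using lnc S \<Lambda> V_bounds(1) by (intro mult_mono integral_nonneg_AE AE_I2) auto
    moreover have "(\<integral>z. regret T z - 8 * ln c * V T z \<partial>L T)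
        = (\<integral>z. regret T z \<partial>L T) - 8 * ln c * (\<integral>z. V T z \<partial>L T)"
      using integrable_regret[of T] integrable_V[of T] by simp
    moreover have "(real T - real K) * (2 / real T) \<le> 2"
      using T0 by (simp add: field_simps)
    moreover have "real K \<le> S"
    proof -
      have "real K = sqrt (real K * real K)" by simp
      also have "\<dots> \<le> S" unfolding S_def using KT' by (intro real_sqrt_le_mono mult_left_mono) auto
      finally show ?thesis .
    qed
    moreover have "1 \<le> S" using KT by (simp add: S_def)
    \<comment> \<open>The total is at most \<open>K + 2 + 16 * \<Lambda> * S\<close>. With
      \<open>K \<le> S\<close> and \<open>1 \<le> S\<close> the first two terms are at most
      \<open>3 * S \<le> 6 * \<Lambda> * S\<close>, and 16 + 6 = 22.\<close>
    ultimately show ?thesis using main[OF KT'] \<Lambda>S by linarith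
  qed
  then show ?thesis by (simp add: bayes_regret_eq \<Lambda>_def S_def)
qed

end

theorem theorem6p1:
  "\<exists>C p :: real. C > 0 \<and> p > 0 \<and>
     (\<forall>(K::nat) (T::nat) (prior :: env measure)
        (post :: nat \<Rightarrow> history \<Rightarrow> env measure) (tie :: nat \<Rightarrow> transcript \<times> env \<Rightarrow> nat measure).
        1 \<le> K \<longrightarrow> 1 \<le> T \<longrightarrow>
        prior \<in> space (prob_algebra (env_space K)) \<longrightarrow>
        (\<forall>n. K \<le> n \<and> n < T \<longrightarrow> argmin_rule K K n (tie (Suc n))) \<longrightarrow>
        is_posterior K K T (fixed_arm K) prior post tie \<longrightarrow>
        bayes_regret K K T (fixed_arm K) prior post tie
          \<le> C * (ln (2 * real K * real T)) powr p * sqrt (real K * real T))"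
proof (rule exI[of _ 22], rule exI[of _ 1], intro conjI allI impI)
  fix K T :: nat and prior post tie
  assume K: "1 \<le> K" and T: "1 \<le> T" and "prior \<in> space (prob_algebra (env_space K))"
    "\<forall>n. K \<le> n \<and> n < T \<longrightarrow> argmin_rule K K n (tie (Suc n))"
    "is_posterior K K T (fixed_arm K) prior post tie"
  then interpret bms_fixed_arms K T prior post tie by unfold_locales auto
  \<comment> \<open>The exponent is \<open>p = 1\<close>; nonnegativity of the logarithm removes
    \<open>powr 1\<close>.\<close>
  have "1 * 1 \<le> (2 * real K) * real T" using K T by (intro mult_mono) auto
  then have "0 \<le> ln (2 * real K * real T)" by (simp add: ln_ge_zero)
  then show "bayes_regret K K T (fixed_arm K) prior post tie
      \<le> 22 * ln (2 * real K * real T) powr 1 * sqrt (real K * real T)"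
    using bayes_regret_bound[OF T] by simp
qed auto

end
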